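(* Let $\alpha\in\mathbb R$, let $\kappa\in\mathbb N_0\cup\{+\infty\}$, and let $(s_j)_{j=0}^\kappa\in\mathcal K^{\ge,e}_{q,\kappa,\alpha}$. Then $(s_0^{[j,\alpha]})_{j=0}^\kappa$ (the sequence whose $j$-th member is the first matrix of the $j$-th $\alpha$-Schur transform of $(s_j)_{j=0}^\kappa$) is exactly the right $\alpha$-Stieltjes parametrization of $(s_j)_{j=0}^\kappa$.
   Context: Let $q\in\mathbb N=\{1,2,\dots\}$; $\mathbb N_0=\{0,1,2,\dots\}$. All sequences consist of complex $q\times q$ matrices; $(s_j)_{j=0}^{\infty}$ is indexed by $\mathbb N_0$, and $\infty-k=\infty$. $A\ge0$ means that $A$ is nonnegative Hermitian (Hermitian positive semidefinite), and $A^\dagger$ is the Moore–Penrose inverse of $A$. Block Hankel matrices. For a sequence $(s_j)$ put $H_n=[s_{j+k}]_{j,k=0}^n$, $s_{\alpha,j}=-\alpha s_j+s_{j+1}$, and $H_{\alpha,n}=[s_{\alpha,j+k}]_{j,k=0}^n$ (whenever the entries are available). Classes. $\mathcal K^{\ge}_{q,0,\alpha}$ is the set of all $(s_j)_{j=0}^0$ with $s_0\ge0$. For $n\ge1$, $\mathcal K^{\ge}_{q,2n,\alpha}$ is the set of all $(s_j)_{j=0}^{2n}$ with $H_n\ge0$ and $H_{\alpha,n-1}\ge0$. For $n\ge0$, $\mathcal K^{\ge}_{q,2n+1,\alpha}$ is the set of all $(s_j)_{j=0}^{2n+1}$ with $H_n\ge0$ and $H_{\alpha,n}\ge0$. $\mathcal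 K^{\ge}_{q,\infty,\alpha}$ is the set of all $(s_j)_{j=0}^\infty$ with $(s_j)_{j=0}^m\in\mathcal K^{\ge}_{q,m,\alpha}$ for all $m\in\mathbb N_0$. For $m\in\mathbb N_0$, $\mathcal K^{\ge,e}_{q,m,\alpha}$ is the set of all $(s_j)_{j=0}^m$ for which there is a complex $q\times q$ matrix $s_{m+1}$ with $(s_j)_{j=0}^{m+1}\in\mathcal K^{\ge}_{q,m+1,\alpha}$; $\mathcal K^{\ge,e}_{q,\infty,\alpha}=\mathcal K^{\ge}_{q,\infty,\alpha}$. Right $\alpha$-Stieltjes parametrization. Put $L_0=s_0$ and, for $n\ge1$, $L_n=s_{2n}-[s_n,\dots,s_{2n-1}]\,H_{n-1}^\dagger\,\begin{bmatrix}s_n\\ \vdots\\ s_{2n-1}\end{bmatrix}$; let $L_{\alpha,n}$ be the matrix built in the same way from the sequence $(s_{\alpha,j})$ in place of $(s_j)$ (so $L_{\alpha,0}=s_{\alpha,0}$). The right $\alpha$-Stieltjes parametrization $(Q_j)_{j=0}^\kappa$ of $(s_j)_{j=0}^\kappa$ is given by $Q_{2k}=L_k$ and $Q_{2k+1}=L_{\alpha,k}$ for all indices not exceeding $\kappa$. $\alpha$-Schur transforms. The $[+,\alpha]$-transform of $(s_j)$ is $(u_j)$ with $u_j=-\alpha s_{j-1}+s_j$, where $s_{-1}=0$. The reciprocal sequence of a sequence $(u_j)$ is given by $u_0^\sharp=u_0^\dagger$ and $u_j^\sharp=-u_0^\dagger\sum_{l=0}^{j-1}u_{j-l}u_l^\sharp$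 for $j\ge1$. Put $s_j^{\sharp,\alpha}=u_j^\sharp$ where $(u_j)$ is the $[+,\alpha]$-transform of $(s_j)$. The first $\alpha$-Schur transform of a sequence $(s_j)_{j=0}^{\kappa}$ with $\kappa\ge1$ is $(s_j^{[1,\alpha]})_{j=0}^{\kappa-1}$ with $s_j^{[1,\alpha]}=-s_0\,s_{j+1}^{\sharp,\alpha}\,s_0$. The $0$-th $\alpha$-Schur transform of $(s_j)$ is $(s_j)$ itself, and for integers $1\le k\le\kappa$ the $k$-th $\alpha$-Schur transform $(s_j^{[k,\alpha]})_{j=0}^{\kappa-k}$ is the first $\alpha$-Schur transform of the $(k-1)$-th one. *)

theory Defs
  imports
    "Jordan_Normal_Form.Schur_Decomposition"
    "HOL-Library.Extended_Nat"
begin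

text \<open>
  A sequence \<open>(s\<^sub>j)\<close>, \<open>0 \<le> j \<le> \<kappa>\<close>, of complex \<open>q \<times> q\<close> matrices is represented by a function
  \<open>s :: nat \<Rightarrow> complex mat\<close>.  For finite \<open>\<kappa>\<close> the values at indices greater than \<open>\<kappa>\<close> carry no
  meaning: no predicate or member with an admissible index defined below depends on them.
\<close>

definition nonneg_hermitian :: "complex mat \<Rightarrow> bool" where
  "nonneg_hermitian A \<longleftrightarrow>
     square_mat A \<and> mat_adjoint A = A \<and>
     (\<forall>v \<in> carrier_vec (dim_row A). 0 \<le> Re ((A *\<^sub>v v) \<bullet>c v))"

text \<open>The Moore--Penrose inverse, characterised by the four Penrose equations.\<close>

definition mp_inverse :: "complex mat \<Rightarrow> complex mat" where
  "mp_inverse A =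
     (THE X. X \<in> carrier_mat (dim_col A) (dim_row A) \<and>
             A * X * A = A \<and> X * A * X = X \<and>
             mat_adjoint (A * X) = A * X \<and> mat_adjoint (X * A) = X * A)"

text \<open>
  The \<open>m \<times> n\<close> block matrix whose block at position \<open>(j, k)\<close> (counted from 0) is the
  \<open>q \<times> q\<close> matrix \<open>B j k\<close>.
\<close>

definition block_mat :: "nat \<Rightarrow> nat \<Rightarrow> nat \<Rightarrow> (nat \<Rightarrow> nat \<Rightarrow> complex mat) \<Rightarrow> complex mat" where
  "block_mat q m n B =
     mat (m * q) (n * q) (\<lambda>(i, l). B (i div q) (l div q) $$ (i mod q, l mod q))"

definition block_hankel :: "nat \<Rightarrow> (nat \<Rightarrow> complex mat) \<Rightarrow> nat \<Rightarrow> complex mat" where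
  "block_hankel q s n = block_mat q (n + 1) (n + 1) (\<lambda>j k. s (j + k))"

definition alpha_seq :: "real \<Rightarrow> (nat \<Rightarrow> complex mat) \<Rightarrow> nat \<Rightarrow> complex mat" where
  "alpha_seq \<alpha> s j = (- complex_of_real \<alpha>) \<cdot>\<^sub>m s j + s (j + 1)"

definition K_fin :: "nat \<Rightarrow> nat \<Rightarrow> real \<Rightarrow> (nat \<Rightarrow> complex mat) \<Rightarrow> bool" where
  "K_fin q m \<alpha> s \<longleftrightarrow>
     (\<forall>j \<le> m. s j \<in> carrier_mat q q) \<and>
     (if m = 0 then nonneg_hermitian (s 0)
      else if even m then
        nonneg_hermitian (block_hankel q s (m div 2)) \<and>
        nonneg_hermitian (block_hankel q (alpha_seq \<alpha> s) (m div 2 - 1))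
      else
        nonneg_hermitian (block_hankel q s (m div 2)) \<and>
        nonneg_hermitian (block_hankel q (alpha_seq \<alpha> s) (m div 2)))"

definition K_inf :: "nat \<Rightarrow> real \<Rightarrow> (nat \<Rightarrow> complex mat) \<Rightarrow> bool" where
  "K_inf q \<alpha> s \<longleftrightarrow> (\<forall>m. K_fin q m \<alpha> s)"

definition K_ext :: "nat \<Rightarrow> enat \<Rightarrow> real \<Rightarrow> (nat \<Rightarrow> complex mat) \<Rightarrow> bool" where
  "K_ext q \<kappa> \<alpha> s =
     (case \<kappa> of
        enat m \<Rightarrow> \<exists>S \<in> carrier_mat q q. K_fin q (m + 1) \<alpha> (s(m + 1 := S))
      | \<infinity> \<Rightarrow> K_inf q \<alpha> s)"

definition schur_L :: "nat \<Rightarrow> (nat \<Rightarrow> complex mat) \<Rightarrow> nat \<Rightarrow> complex mat" where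
  "schur_L q s n =
     (if n = 0 then s 0
      else s (2 * n) - block_mat q 1 n (\<lambda>j k. s (n + k))
                       * mp_inverse (block_hankel q s (n - 1))
                       * block_mat q n 1 (\<lambda>j k. s (n + j)))"

definition stieltjes_param ::
  "nat \<Rightarrow> real \<Rightarrow> (nat \<Rightarrow> complex mat) \<Rightarrow> nat \<Rightarrow> complex mat" where
  "stieltjes_param q \<alpha> s j =
     (if even j then schur_L q s (j div 2) else schur_L q (alpha_seq \<alpha> s) (j div 2))"

definition plus_transform ::
  "nat \<Rightarrow> real \<Rightarrow> (nat \<Rightarrow> complex mat) \<Rightarrow> nat \<Rightarrow> complex mat" where
  "plus_transform q \<alpha> s j =
     (- complex_of_real \<alpha>) \<cdot>\<^sub>m (if j = 0 then 0\<^sub>m q q else s (j - 1)) + s j"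

text \<open>The sum \<open>f 0 + \<dots> + f (n - 1)\<close> of \<open>q \<times> q\<close> matrices.\<close>

definition mat_sum :: "nat \<Rightarrow> (nat \<Rightarrow> complex mat) \<Rightarrow> nat \<Rightarrow> complex mat" where
  "mat_sum q f n = mat q q (\<lambda>(a, b). \<Sum>l<n. f l $$ (a, b))"

lemma mat_sum_cong [fundef_cong]:
  assumes "q = q'" "n = n'" "\<And>l. l < n' \<Longrightarrow> f l = g l"
  shows "mat_sum q f n = mat_sum q' g n'"
  using assms by (auto simp: mat_sum_def intro!: cong_mat sum.cong)

fun reciprocal :: "nat \<Rightarrow> (nat \<Rightarrow> complex mat) \<Rightarrow> nat \<Rightarrow> complex mat" where
  "reciprocal q u j =
     (if j = 0 then mp_inverse (u 0)
      else - mp_inverse (u 0) * mat_sum q (\<lambda>l. u (j - l) * reciprocal q u l) j)"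

declare reciprocal.simps [simp del]

definition schur_first ::
  "nat \<Rightarrow> real \<Rightarrow> (nat \<Rightarrow> complex mat) \<Rightarrow> nat \<Rightarrow> complex mat" where
  "schur_first q \<alpha> s j =
     - s 0 * reciprocal q (plus_transform q \<alpha> s) (j + 1) * s 0"

fun schur_transform ::
  "nat \<Rightarrow> real \<Rightarrow> nat \<Rightarrow> (nat \<Rightarrow> complex mat) \<Rightarrow> nat \<Rightarrow> complex mat" where
  "schur_transform q \<alpha> 0 s = s"
| "schur_transform q \<alpha> (Suc k) s = schur_first q \<alpha> (schur_transform q \<alpha> k s)"

end

theory Submission
  imports Defs "HOL-Computational_Algebra.Formal_Power_Series" "Jordan_Normal_Form.Gauss_Jordan_Elimination"
begin

text \<open>
  Attach to a sequence \<open>(s\<^sub>j)\<close> its generating function \<open>S(z) = \<Sum> s\<^sub>j z\<^sup>j\<close>, a matrix over the formal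
  power series.  Up to the order of the entries, the linear system behind the Schur complement
  \<open>L\<^sub>n\<close> is a Pade problem: find a matrix polynomial \<open>R\<close> of degree at most \<open>n\<close> with \<open>R(0) = I\<close> such
  that \<open>S R = N + z\<^bsup>2n\<^esup> \<Lambda>\<close> with a polynomial \<open>N\<close> of degree less than \<open>n\<close>.  For Hermitian \<open>s\<^sub>j\<close>
  every such denominator \<open>R\<close> gives \<open>L\<^sub>n = \<Lambda>(0)\<close> (lemma \<open>schur_L_eq_conv\<close>), and a denominator
  exists as soon as \<open>H\<^sub>n \<ge> 0\<close>, because the columns of a positive semidefinite block matrix
  satisfy a range inclusion (lemmas \<open>four_block_range_inclusion\<close> and \<open>pade_denominator_exists\<close>).

  The Schur transform acts very simply on denominators.  Suppose first that \<open>s\<^sub>0\<close> is invertible.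
  Put \<open>u = (1 - \<alpha>z) S\<close>.  Then the reciprocal sequence has the generating function
  \<open>V = u\<^bsup>-1\<^esup>\<close>, the first Schur transform \<open>T\<close> satisfies \<open>z T = s\<^sub>0 - s\<^sub>0 V s\<^sub>0\<close>, and the generating
  function \<open>S\<^sub>\<alpha>\<close> of \<open>(s\<^bsub>\<alpha>,j\<^esub>)\<close> satisfies \<open>z S\<^sub>\<alpha> = u - s\<^sub>0\<close>.
  If \<open>S\<^sub>\<alpha> R = N + z\<^bsup>2n\<^esup> \<Lambda>\<close>, then \<open>u R = M + z\<^bsup>2n+1\<^esup> \<Lambda>\<close> with \<open>M = s\<^sub>0 R + z N\<close>, so
  \<open>R' = s\<^sub>0\<^bsup>-1\<^esup> M\<close> has degree at most \<open>n\<close>, \<open>R'(0) = I\<close>, and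
  \<open>z T R' = M - s\<^sub>0 V M = z N + z\<^bsup>2n+1\<^esup> s\<^sub>0 V \<Lambda>\<close>.  Since \<open>s\<^sub>0 V(0) = I\<close>, the same remainder \<open>\<Lambda>(0)\<close>
  appears, that is, \<open>L\<^sub>n(t) = L\<^bsub>\<alpha>,n\<^esub>(s)\<close> (lemma \<open>schur_first_denominator\<close>).
  In the same way, \<open>S R = N + z\<^bsup>2n+2\<^esup> \<Lambda>\<close> makes \<open>s\<^sub>0\<^bsup>-1\<^esup> N\<close> a denominator for \<open>T\<^sub>\<alpha>\<close>, and
  \<open>L\<^bsub>\<alpha>,n\<^esub>(t) = L\<^bsub>n+1\<^esub>(s)\<close> (lemma \<open>alpha_schur_first_denominator\<close>).  So the parametrization of \<open>t\<close>
  is the parametrization of \<open>s\<close> with its first member removed; as that first member is \<open>s\<^sub>0\<close>, iterating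
  the Schur transform and reading off the first matrices lists the whole parametrization.

  For singular \<open>s\<^sub>0\<close> the inverse becomes the Moore--Penrose inverse and \<open>I\<close> becomes the orthogonal
  projection \<open>P\<close> onto the range of \<open>s\<^sub>0\<close>; the computations survive because all \<open>s\<^sub>j\<close> have their range
  inside that of \<open>s\<^sub>0\<close>, and adding \<open>I - P\<close> to \<open>R'\<close> restores \<open>R'(0) = I\<close>.
  The iteration does not carry positivity along.  It carries only the consequences of positivity that
  the argument uses, namely that the entries are Hermitian and that the Pade problems of all admissible
  orders are solvable (predicate \<open>hermitian_pade_solvable\<close>).  This predicate already forces the
  inclusion of the ranges in that of \<open>s\<^sub>0\<close> (lemma \<open>hermitian_pade_solvable_dominated\<close>), and by the two transfer lemmas it passes
  from \<open>s\<close> to \<open>t\<close>.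
\<close>

section \<open>Adjoints and the Moore--Penrose inverse\<close>

lemma mat_adjoint_dim [simp]:
  "dim_row (mat_adjoint A) = dim_col A" "dim_col (mat_adjoint A) = dim_row A"
  by (auto simp: mat_adjoint_def mat_of_rows_def)

lemma mat_adjoint_carrier [simp]:
  "A \<in> carrier_mat n m \<Longrightarrow> mat_adjoint A \<in> carrier_mat m n"
  by (intro carrier_matI) (simp_all add: carrier_matD)

lemma mat_adjoint_index [simp]:
  fixes A :: "complex mat"
  shows "i < dim_col A \<Longrightarrow> j < dim_row A \<Longrightarrow> mat_adjoint A $$ (i, j) = cnj (A $$ (j, i))"
  by (auto simp: mat_adjoint_def mat_of_rows_def)

lemma mat_adjoint_mat_adjoint [simp]:
  fixes A :: "complex mat"
  shows "mat_adjoint (mat_adjoint A) = A"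
  by (rule eq_matI) auto

lemma mat_adjoint_mult:
  fixes A B :: "complex mat"
  assumes "A \<in> carrier_mat n m" "B \<in> carrier_mat m k"
  shows "mat_adjoint (A * B) = mat_adjoint B * mat_adjoint A"
  using assms by (intro eq_matI) (auto simp: scalar_prod_def mult.commute)

lemma mat_adjoint_minus:
  fixes A B :: "complex mat"
  assumes "A \<in> carrier_mat n m" "B \<in> carrier_mat n m"
  shows "mat_adjoint (A - B) = mat_adjoint A - mat_adjoint B"
  using assms by (intro eq_matI) auto

lemma mat_adjoint_add:
  fixes A B :: "complex mat"
  assumes "A \<in> carrier_mat n m" "B \<in> carrier_mat n m"
  shows "mat_adjoint (A + B) = mat_adjoint A + mat_adjoint B"
  using assms by (intro eq_matI) auto

lemma mat_adjoint_smult: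
  fixes A :: "complex mat"
  shows "mat_adjoint (c \<cdot>\<^sub>m A) = cnj c \<cdot>\<^sub>m mat_adjoint A"
  by (intro eq_matI) auto

lemma mat_adjoint_one [simp]: "mat_adjoint (1\<^sub>m n :: complex mat) = 1\<^sub>m n"
  by (intro eq_matI) auto

lemma mat_adjoint_zero [simp]: "mat_adjoint (0\<^sub>m n m :: complex mat) = 0\<^sub>m m n"
  by (intro eq_matI) auto

lemma minus_mat_eq_0_iff:
  fixes A B :: "'a :: ab_group_add mat"
  assumes "A \<in> carrier_mat n m" "B \<in> carrier_mat n m"
  shows "A - B = 0\<^sub>m n m \<longleftrightarrow> A = B"
proof
  assume *: "A - B = 0\<^sub>m n m"
  show "A = B"
  proof (rule eq_matI)
    fix i j assume "i < dim_row B" "j < dim_col B"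
    thus "A $$ (i, j) = B $$ (i, j)"
      using arg_cong[OF *, of "\<lambda>M. M $$ (i, j)"] assms by auto
  qed (use assms in auto)
qed (use assms in auto)

lemma index_mult_mat_sum:
  assumes "A \<in> carrier_mat n m" "B \<in> carrier_mat m k" "i < n" "j < k"
  shows "(A * B) $$ (i, j) = (\<Sum>l<m. A $$ (i, l) * B $$ (l, j))"
  using assms by (simp add: scalar_prod_def atLeast0LessThan)

text \<open>
  The diagonal of \<open>M\<^sup>* M\<close> consists of the squared Euclidean lengths of the columns of \<open>M\<close>.
\<close>
lemma adjoint_mult_self_eq_0:
  fixes M :: "complex mat"
  assumes M: "M \<in> carrier_mat n m" and "mat_adjoint M * M = 0\<^sub>m m m"
  shows "M = 0\<^sub>m n m"
proof (rule eq_matI)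
  fix i j assume i: "i < dim_row (0\<^sub>m n m :: complex mat)" and j: "j < dim_col (0\<^sub>m n m :: complex mat)"
  have "0 = (mat_adjoint M * M) $$ (j, j)" using assms j by simp
  also have "\<dots> = (\<Sum>i<n. cnj (M $$ (i, j)) * M $$ (i, j))"
    using M j by (simp add: scalar_prod_def atLeast0LessThan)
  also have "\<dots> = of_real (\<Sum>i<n. (cmod (M $$ (i, j)))\<^sup>2)"
    by (simp add: complex_norm_square[symmetric] mult.commute)
  finally have "(\<Sum>i<n. (cmod (M $$ (i, j)))\<^sup>2) = 0"
    using of_real_eq_0_iff by metis
  hence "\<forall>i<n. (cmod (M $$ (i, j)))\<^sup>2 = 0"
    by (subst (asm) sum_nonneg_eq_0_iff) auto
  thus "M $$ (i, j) = 0\<^sub>m n m $$ (i, j)" using i j by simp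
qed (use M in auto)

text \<open>
  Distributivity and associativity with premises on dimensions only: such premises contain no
  unknowns, so the simplifier can discharge them for arbitrarily nested products.
\<close>
lemma assoc_mult_mat_dim:
  fixes A :: "'a :: semiring_0 mat"
  assumes "dim_col A = dim_row B" "dim_col B = dim_row C"
  shows "A * B * C = A * (B * C)"
  by (rule assoc_mult_mat) (use assms in auto)

text \<open>
  Allows a known product \<open>X Y = Z\<close> to be contracted at the head of a right-nested product.
\<close>
lemma mult_assoc_dim_eq:
  fixes X :: "'a :: semiring_0 mat"
  assumes "X * Y = Z" "dim_col X = dim_row Y" "dim_col Y = dim_row W"
  shows "X * (Y * W) = Z * W"
  using assms(1) by (simp add: assoc_mult_mat_dim[symmetric, OF assms(2,3)])

lemma mult_minus_distrib_mat_dim: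
  fixes A :: "'a :: ring mat"
  assumes "dim_col A = dim_row B" "dim_row B = dim_row C" "dim_col B = dim_col C"
  shows "A * (B - C) = A * B - A * C"
  by (rule mult_minus_distrib_mat) (use assms in auto)

lemma minus_mult_distrib_mat_dim:
  fixes A :: "'a :: ring mat"
  assumes "dim_col A = dim_row C" "dim_row A = dim_row B" "dim_col A = dim_col B"
  shows "(A - B) * C = A * C - B * C"
  by (rule minus_mult_distrib_mat) (use assms in auto)

lemma mult_add_distrib_mat_dim:
  fixes A :: "'a :: semiring_0 mat"
  assumes "dim_col A = dim_row B" "dim_row B = dim_row C" "dim_col B = dim_col C"
  shows "A * (B + C) = A * B + A * C"
  by (rule mult_add_distrib_mat) (use assms in auto)

lemma add_mult_distrib_mat_dim:
  fixes A :: "'a :: semiring_0 mat"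
  assumes "dim_col A = dim_row C" "dim_row A = dim_row B" "dim_col A = dim_col B"
  shows "(A + B) * C = A * C + B * C"
  by (rule add_mult_distrib_mat) (use assms in auto)

lemmas mat_dim_simps = assoc_mult_mat_dim mult_minus_distrib_mat_dim minus_mult_distrib_mat_dim
  mult_add_distrib_mat_dim add_mult_distrib_mat_dim

lemma mat_adjoint_mult_dim:
  fixes A B :: "complex mat"
  assumes "dim_col A = dim_row B"
  shows "mat_adjoint (A * B) = mat_adjoint B * mat_adjoint A"
  by (rule mat_adjoint_mult) (use assms in auto)

text \<open>
  If \<open>C = P A\<close> is the reduced row echelon form, then picking the pivot columns of \<open>C\<close> by a
  \<open>0\<close>-\<open>1\<close> matrix \<open>E\<close> turns \<open>C E\<close> into the projection onto the pivot rows, which fixes \<open>C\<close>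
  because the remaining rows vanish.  Hence \<open>E P\<close> is an inner inverse of \<open>A\<close>.
\<close>
lemma inner_inverse_exists:
  fixes A :: "'a :: field mat"
  assumes A: "A \<in> carrier_mat n m"
  shows "\<exists>G \<in> carrier_mat m n. A * G * A = A"
proof -
  define C where "C = gauss_jordan_single A"
  note gj = gauss_jordan_single[OF A C_def[symmetric]]
  have C: "C \<in> carrier_mat n m" by (rule gj)
  obtain P Q where PQ: "C = P * A" "P \<in> carrier_mat n n" "Q \<in> carrier_mat n n" "Q * P = 1\<^sub>m n"
    using gj(4) by auto
  obtain f where f: "pivot_fun C f m" using gj(3) C unfolding row_echelon_form_def by auto
  note pf = pivot_funD[OF carrier_matD(1)[OF C] f]
  define E where "E = mat m n (\<lambda>(a, i). if a = f i then 1 else 0 :: 'a)"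
  have E: "E \<in> carrier_mat m n" by (simp add: E_def)
  have CE: "(C * E) $$ (k, i) = (if k = i \<and> f i < m then 1 else 0)" if "k < n" "i < n" for k i
  proof -
    have "(C * E) $$ (k, i) = (\<Sum>a<m. C $$ (k, a) * (if a = f i then 1 else 0))"
      using that C by (simp add: E_def scalar_prod_def atLeast0LessThan)
    also have "\<dots> = (\<Sum>a<m. if a = f i then C $$ (k, a) else 0)"
      by (intro sum.cong) auto
    also have "\<dots> = (if f i < m then C $$ (k, f i) else 0)"
      by simp
    finally show ?thesis using pf(4,5) that by auto
  qed
  have CEC: "C * E * C = C"
  proof (rule eq_matI)
    fix i j assume ij: "i < dim_row C" "j < dim_col C"
    hence i: "i < n" and j: "j < m" using C by auto
    have "(C * E * C) $$ (i, j) = (\<Sum>k<n. (C * E) $$ (i, k) * C $$ (k, j))"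
      using i j C E by (intro index_mult_mat_sum) auto
    also have "\<dots> = (\<Sum>k<n. if k = i then (if f i < m then C $$ (i, j) else 0) else 0)"
      using CE i by (intro sum.cong) auto
    also have "\<dots> = (if f i < m then C $$ (i, j) else 0)" using i by simp
    also have "\<dots> = C $$ (i, j)" using pf(1)[OF i] pf(2)[OF i, of j] j by auto
    finally show "(C * E * C) $$ (i, j) = C $$ (i, j)" .
  qed (use C E in auto)
  note [simp] = carrier_matD[OF A] carrier_matD[OF C] carrier_matD[OF E] carrier_matD[OF PQ(2)] carrier_matD[OF PQ(3)]
  have QC: "Q * C = A"
    by (simp add: PQ(1) mult_assoc_dim_eq[OF PQ(4)])
  have "A * (E * P) * A = Q * (C * E * (P * A))"
    by (simp add: assoc_mult_mat_dim flip: QC)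
  also have "C * E * (P * A) = C" using CEC by (simp flip: PQ(1))
  finally have "A * (E * P) * A = A" by (simp only: QC)
  thus ?thesis using E PQ by (intro bexI[of _ "E * P"]) auto
qed

text \<open>
  The orthogonal projection onto the column space of \<open>A\<close> is \<open>P = A G A\<^sup>*\<close>, where \<open>G\<close> is any inner
  inverse of \<open>A\<^sup>* A\<close>.  The difference \<open>P A - A = A W\<close> satisfies \<open>A\<^sup>* A W = 0\<close>, hence
  \<open>(A W)\<^sup>* (A W) = 0\<close>, so \<open>P\<close> fixes \<open>A\<close>.  Then \<open>P P\<^sup>* = P\<^sup>*\<close>, which makes \<open>P\<close> Hermitian.
\<close>
lemma range_projection_exists:
  fixes A :: "complex mat"
  assumes A: "A \<in> carrier_mat n m"
  shows "\<exists>W \<in> carrier_mat m n. mat_adjoint (A * W) = A * W \<and> A * W * A = A"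
proof -
  let ?B = "mat_adjoint A"
  have B: "?B \<in> carrier_mat m n" using A by simp
  obtain G where G: "G \<in> carrier_mat m m" and GG: "(?B * A) * G * (?B * A) = ?B * A"
    using inner_inverse_exists[of "?B * A" m m] A B by auto
  note [simp] = carrier_matD[OF A] carrier_matD[OF G]
  define P where "P = A * (G * ?B)"
  define W where "W = G * ?B * A - 1\<^sub>m m"
  have dims [simp]: "dim_row P = n" "dim_col P = n" "dim_row W = m" "dim_col W = m"
    by (simp_all add: P_def W_def)
  have A1: "A * 1\<^sub>m m = A" using A by simp
  have PAm: "P * A - A = A * W"
    by (simp add: P_def W_def mat_dim_simps A1)
  have BPA: "?B * (P * A) = ?B * A"
    using GG by (simp add: P_def mat_dim_simps)
  have "?B * (A * W) = 0\<^sub>m m m"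
    by (simp add: PAm[symmetric] mat_dim_simps BPA minus_mat_eq_0_iff[of _ m m] carrier_matI)
  hence "mat_adjoint (A * W) * (A * W) = 0\<^sub>m m m"
    by (simp add: mat_adjoint_mult_dim mat_dim_simps)
  hence "A * W = 0\<^sub>m n m" by (rule adjoint_mult_self_eq_0[rotated]) (simp add: carrier_matI)
  hence PA: "P * A = A" using PAm minus_mat_eq_0_iff[of "P * A" n m A] by (simp add: carrier_matI)
  have "P * mat_adjoint P = P * A * (mat_adjoint G * ?B)"
    by (simp add: P_def mat_adjoint_mult_dim mat_dim_simps)
  also have "\<dots> = mat_adjoint P"
    unfolding PA by (simp add: P_def mat_adjoint_mult_dim mat_dim_simps)
  finally have "P * mat_adjoint P = mat_adjoint P" .
  moreover have "mat_adjoint (P * mat_adjoint P) = P * mat_adjoint P"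
    by (simp add: mat_adjoint_mult_dim)
  ultimately have "mat_adjoint P = P" by (metis mat_adjoint_mat_adjoint)
  thus ?thesis using PA unfolding P_def by (intro bexI[of _ "G * ?B"]) (auto intro: carrier_matI)
qed

lemma penrose_unique:
  fixes A X Y :: "complex mat"
  assumes A: "A \<in> carrier_mat n m" and X: "X \<in> carrier_mat m n" and Y: "Y \<in> carrier_mat m n"
    and AXA: "A * X * A = A" and XAX: "X * A * X = X"
    and AX: "mat_adjoint (A * X) = A * X" and XA: "mat_adjoint (X * A) = X * A"
    and AYA: "A * Y * A = A" and YAY: "Y * A * Y = Y"
    and AY: "mat_adjoint (A * Y) = A * Y" and YA: "mat_adjoint (Y * A) = Y * A"
  shows "X = Y"
proof -
  note [simp] = carrier_matD[OF A] carrier_matD[OF X] carrier_matD[OF Y]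
  have "A * X = mat_adjoint ((A * Y * A) * X)" by (simp only: AX AYA)
  also have "\<dots> = mat_adjoint (A * X) * mat_adjoint (A * Y)"
    by (simp add: mat_adjoint_mult_dim mat_dim_simps)
  also have "\<dots> = (A * X * A) * Y"
    unfolding AX AY by (simp add: mat_dim_simps)
  finally have 1: "A * X = A * Y" by (simp only: AXA)
  have "X * A = mat_adjoint (X * (A * Y * A))" by (simp only: XA AYA)
  also have "\<dots> = mat_adjoint (Y * A) * mat_adjoint (X * A)"
    by (simp add: mat_adjoint_mult_dim mat_dim_simps)
  also have "\<dots> = Y * (A * X * A)"
    unfolding XA YA by (simp add: mat_dim_simps)
  finally have 2: "X * A = Y * A" by (simp only: AXA)
  have "X = Y * A * X" using XAX by (simp only: 2)
  also have "\<dots> = Y * (A * X)" by (simp add: mat_dim_simps)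
  also have "\<dots> = Y * A * Y" unfolding 1 by (simp add: mat_dim_simps)
  finally show ?thesis by (simp only: YAY)
qed

text \<open>
  With the projections \<open>A W\<close> onto the range of \<open>A\<close> and \<open>Q\<close> onto the range of \<open>A\<^sup>*\<close>, any inner
  inverse \<open>G\<close> is corrected on both sides to \<open>X = Q G (A W)\<close>; then \<open>A X = A W\<close> and \<open>X A = Q\<close>.
\<close>
lemma penrose_exists:
  fixes A :: "complex mat"
  assumes A: "A \<in> carrier_mat n m"
  shows "\<exists>X \<in> carrier_mat m n. A * X * A = A \<and> X * A * X = X \<and>
           mat_adjoint (A * X) = A * X \<and> mat_adjoint (X * A) = X * A"
proof -
  obtain G where G: "G \<in> carrier_mat m n" "A * G * A = A" using inner_inverse_exists[OF A] by auto
  obtain W where W: "W \<in> carrier_mat m n" and P: "mat_adjoint (A * W) = A * W" "A * W * A = A"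
    using range_projection_exists[OF A] by auto
  obtain W' where W': "W' \<in> carrier_mat n m"
    and Q': "mat_adjoint (mat_adjoint A * W') = mat_adjoint A * W'" "mat_adjoint A * W' * mat_adjoint A = mat_adjoint A"
    using range_projection_exists[OF mat_adjoint_carrier[OF A]] by auto
  note [simp] = carrier_matD[OF A] carrier_matD[OF G(1)] carrier_matD[OF W] carrier_matD[OF W']
  define Q where "Q = mat_adjoint A * W'"
  have [simp]: "dim_row Q = m" "dim_col Q = m" by (simp_all add: Q_def)
  have Qeq: "Q = mat_adjoint W' * A"
    using Q'(1) by (simp add: mat_adjoint_mult_dim Q_def)
  have AQ: "A * Q = A"
  proof -
    have "mat_adjoint (Q * mat_adjoint A) = A" using Q'(2) by (simp add: Q_def)
    moreover have "mat_adjoint Q = Q" using Q'(1) by (simp add: Q_def)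
    ultimately show ?thesis by (simp add: mat_adjoint_mult_dim)
  qed
  have QQ: "Q * Q = Q"
  proof -
    have "Q * Q = mat_adjoint W' * (A * Q)" by (subst Qeq) (simp add: mat_dim_simps)
    thus ?thesis by (simp only: AQ Qeq[symmetric])
  qed
  define X where "X = Q * (G * (A * W))"
  have [simp]: "dim_row X = m" "dim_col X = n" by (simp_all add: X_def)
  have AX: "A * X = A * W"
  proof -
    have "A * X = A * Q * (G * (A * W))" by (simp add: X_def mat_dim_simps)
    also have "\<dots> = (A * G * A) * W" unfolding AQ by (simp add: mat_dim_simps)
    finally show ?thesis using G by simp
  qed
  have XA: "X * A = Q"
  proof -
    have "X * A = Q * (G * (A * W * A))" by (simp add: X_def mat_dim_simps)
    also have "\<dots> = mat_adjoint W' * (A * G * A)" unfolding P Qeq by (simp add: mat_dim_simps)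
    also have "\<dots> = Q" by (simp only: G Qeq)
    finally show ?thesis .
  qed
  have "X * A * X = (Q * Q) * (G * (A * W))"
    unfolding XA unfolding X_def by (simp add: mat_dim_simps)
  hence "X * A * X = X" unfolding QQ X_def .
  moreover have "A * X * A = A" unfolding AX by (rule P)
  moreover have "X \<in> carrier_mat m n" by (simp add: carrier_matI)
  ultimately show ?thesis using AX XA P Q' Q_def by (intro bexI[of _ X]) auto
qed

lemma mp_inverse:
  assumes A: "A \<in> carrier_mat n m"
  shows "mp_inverse A \<in> carrier_mat m n"
    "A * mp_inverse A * A = A" "mp_inverse A * A * mp_inverse A = mp_inverse A"
    "mat_adjoint (A * mp_inverse A) = A * mp_inverse A"
    "mat_adjoint (mp_inverse A * A) = mp_inverse A * A"
proof -
  let ?P = "\<lambda>X. X \<in> carrier_mat m n \<and> A * X * A = A \<and> X * A * X = X \<and>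
             mat_adjoint (A * X) = A * X \<and> mat_adjoint (X * A) = X * A"
  have "?P (THE X. ?P X)"
  proof (rule theI')
    show "\<exists>!X. ?P X"
      using penrose_exists[OF A] penrose_unique[OF A] by (intro ex_ex1I) blast+
  qed
  moreover have "mp_inverse A = (THE X. ?P X)" unfolding mp_inverse_def using A by simp
  ultimately have "?P (mp_inverse A)" by simp
  thus "mp_inverse A \<in> carrier_mat m n"
    "A * mp_inverse A * A = A" "mp_inverse A * A * mp_inverse A = mp_inverse A"
    "mat_adjoint (A * mp_inverse A) = A * mp_inverse A"
    "mat_adjoint (mp_inverse A * A) = mp_inverse A * A" by blast+
qed

text \<open>
  For Hermitian \<open>A\<close> the adjoint of the Moore--Penrose inverse solves the Penrose equations as well,
  so it equals the Moore--Penrose inverse by uniqueness.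
\<close>
lemma mp_inverse_hermitian:
  assumes A: "A \<in> carrier_mat n n" and h: "mat_adjoint A = A"
  shows "mat_adjoint (mp_inverse A) = mp_inverse A" "mp_inverse A * A = A * mp_inverse A"
proof -
  let ?X = "mp_inverse A" and ?Y = "mat_adjoint (mp_inverse A)"
  note X = mp_inverse[OF A]
  note [simp] = carrier_matD[OF A] carrier_matD[OF X(1)]
  have YA: "?Y * A = A * ?X" using X(4) h by (simp add: mat_adjoint_mult_dim)
  have AY: "A * ?Y = ?X * A" using X(5) h by (simp add: mat_adjoint_mult_dim)
  have AYA: "A * ?Y * A = A"
    using arg_cong[OF X(2), of mat_adjoint] h by (simp add: mat_adjoint_mult_dim mat_dim_simps)
  have YAY: "?Y * A * ?Y = ?Y"
    using arg_cong[OF X(3), of mat_adjoint] h by (simp add: mat_adjoint_mult_dim mat_dim_simps)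
  have Y: "?Y \<in> carrier_mat n n" by (simp add: carrier_matI)
  show 1: "?Y = ?X"
    by (rule penrose_unique[OF A Y X(1) AYA YAY _ _ X(2-5)]) (simp_all only: AY YA X(4,5))
  show "?X * A = A * ?X" using YA unfolding 1 .
qed

section \<open>Block matrices\<close>

lemma block_mat_carrier [simp]: "block_mat q m n B \<in> carrier_mat (m * q) (n * q)"
  by (simp add: block_mat_def)

lemma block_mat_dim [simp]:
  "dim_row (block_mat q m n B) = m * q" "dim_col (block_mat q m n B) = n * q"
  by (simp_all add: block_mat_def)

lemma block_index_less: "j < m \<Longrightarrow> a < q \<Longrightarrow> j * q + a < m * (q :: nat)"
proof -
  assume "j < m" "a < q"
  hence "j * q + a < (j + 1) * q" by simp
  also have "\<dots> \<le> m * q" using \<open>j < m\<close> by (intro mult_right_mono) auto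
  finally show ?thesis .
qed

lemma block_index_div_mod:
  assumes "i < m * (q :: nat)"
  shows "i div q < m" "i mod q < q"
  using assms by (auto simp: less_mult_imp_div_less) (cases "q = 0"; simp)

lemma block_mat_index:
  assumes "j < m" "k < n" "a < q" "b < q"
  shows "block_mat q m n B $$ (j * q + a, k * q + b) = B j k $$ (a, b)"
  using assms by (simp add: block_mat_def block_index_less)

lemma block_mat_eqI:
  assumes "\<And>j k. j < m \<Longrightarrow> k < n \<Longrightarrow> B j k = C j k"
  shows "block_mat q m n B = block_mat q m n C"
  unfolding block_mat_def using assms block_index_div_mod by (intro cong_mat) auto

lemma block_mat_1_1:
  assumes "B 0 0 \<in> carrier_mat q q"
  shows "block_mat q 1 1 B = B 0 0"
  using assms by (intro eq_matI) (auto simp: block_mat_def)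

lemma mat_sum_carrier [simp]: "mat_sum q f n \<in> carrier_mat q q"
  by (simp add: mat_sum_def)

lemma mat_sum_dim [simp]: "dim_row (mat_sum q f n) = q" "dim_col (mat_sum q f n) = q"
  by (simp_all add: mat_sum_def)

lemma mat_sum_index: "a < q \<Longrightarrow> b < q \<Longrightarrow> mat_sum q f n $$ (a, b) = (\<Sum>l<n. f l $$ (a, b))"
  by (simp add: mat_sum_def)

lemma block_mat_mult:
  assumes B: "\<And>j k. j < m \<Longrightarrow> k < n \<Longrightarrow> B j k \<in> carrier_mat q q"
    and C: "\<And>j k. j < n \<Longrightarrow> k < p \<Longrightarrow> C j k \<in> carrier_mat q q"
  shows "block_mat q m n B * block_mat q n p C =
           block_mat q m p (\<lambda>j k. mat_sum q (\<lambda>l. B j l * C l k) n)"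
proof (rule eq_matI)
  fix i l assume "i < dim_row (block_mat q m p (\<lambda>j k. mat_sum q (\<lambda>l. B j l * C l k) n))"
    "l < dim_col (block_mat q m p (\<lambda>j k. mat_sum q (\<lambda>l. B j l * C l k) n))"
  hence i: "i < m * q" and l: "l < p * q" by auto
  let ?j = "i div q" and ?a = "i mod q" and ?k = "l div q" and ?b = "l mod q"
  note ij = block_index_div_mod[OF i] and lk = block_index_div_mod[OF l]
  let ?f = "\<lambda>x. B ?j (x div q) $$ (?a, x mod q) * C (x div q) ?k $$ (x mod q, ?b)"
  have "(block_mat q m n B * block_mat q n p C) $$ (i, l) =
          (\<Sum>x<n * q. block_mat q m n B $$ (i, x) * block_mat q n p C $$ (x, l))"
    using i l by (intro index_mult_mat_sum) auto
  also have "\<dots> = (\<Sum>x<n * q. ?f x)"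
    using i l by (intro sum.cong) (auto simp: block_mat_def)
  also have "\<dots> = (\<Sum>y<n. \<Sum>x\<in>{y * q..<y * q + q}. ?f x)"
    by (simp add: sum.nat_group)
  also have "\<dots> = (\<Sum>y<n. \<Sum>c<q. ?f (y * q + c))"
  proof (rule sum.cong[OF refl])
    fix y
    show "(\<Sum>x\<in>{y * q..<y * q + q}. ?f x) = (\<Sum>c<q. ?f (y * q + c))"
      using sum.shift_bounds_nat_ivl[of ?f 0 "y * q" q]
      by (simp add: atLeast0LessThan add.commute)
  qed
  also have "\<dots> = (\<Sum>y<n. \<Sum>c<q. B ?j y $$ (?a, c) * C y ?k $$ (c, ?b))"
    by (intro sum.cong) auto
  also have "\<dots> = (\<Sum>y<n. (B ?j y * C y ?k) $$ (?a, ?b))"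
    using ij lk by (intro sum.cong refl index_mult_mat_sum[OF B C, symmetric]) auto
  also have "\<dots> = block_mat q m p (\<lambda>j k. mat_sum q (\<lambda>l. B j l * C l k) n) $$ (i, l)"
    using i l ij lk by (simp add: block_mat_def mat_sum_index)
  finally show "(block_mat q m n B * block_mat q n p C) $$ (i, l) =
    block_mat q m p (\<lambda>j k. mat_sum q (\<lambda>l. B j l * C l k) n) $$ (i, l)" .
qed auto

lemma block_mat_blocks:
  assumes "M \<in> carrier_mat (m * q) (n * q)"
  shows "block_mat q m n (\<lambda>j k. mat q q (\<lambda>(a, b). M $$ (j * q + a, k * q + b))) = M"
  using assms block_index_div_mod by (intro eq_matI) (auto simp: block_mat_def)

text \<open>
  Blocks can be compared one by one, since they do not overlap.
\<close>
lemma block_mat_eq_D: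
  assumes "block_mat q m n B = block_mat q m n C" "j < m" "k < n"
    and "B j k \<in> carrier_mat q q" "C j k \<in> carrier_mat q q"
  shows "B j k = C j k"
proof (rule eq_matI)
  fix a b assume "a < dim_row (C j k)" "b < dim_col (C j k)"
  hence "a < q" "b < q" using assms by auto
  thus "B j k $$ (a, b) = C j k $$ (a, b)"
    using arg_cong[OF assms(1), of "\<lambda>M. M $$ (j * q + a, k * q + b)"] assms(2,3)
    by (simp add: block_mat_index)
qed (use assms in auto)

lemma mat_adjoint_block_mat:
  assumes "\<And>j k. j < m \<Longrightarrow> k < n \<Longrightarrow> B j k \<in> carrier_mat q q"
  shows "mat_adjoint (block_mat q m n B) = block_mat q n m (\<lambda>j k. mat_adjoint (B k j))"
proof (rule eq_matI)
  fix i l assume "i < dim_row (block_mat q n m (\<lambda>j k. mat_adjoint (B k j)))"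
    "l < dim_col (block_mat q n m (\<lambda>j k. mat_adjoint (B k j)))"
  hence i: "i < n * q" and l: "l < m * q" by auto
  show "mat_adjoint (block_mat q m n B) $$ (i, l) = block_mat q n m (\<lambda>j k. mat_adjoint (B k j)) $$ (i, l)"
    using i l block_index_div_mod[OF i] block_index_div_mod[OF l] assms[of "l div q" "i div q"]
    by (simp add: block_mat_def)
qed auto

section \<open>Positive semidefinite block matrices\<close>

lemma scalar_prod_adjoint:
  fixes A :: "complex mat"
  assumes A: "A \<in> carrier_mat n m" and v: "v \<in> carrier_vec m" and w: "w \<in> carrier_vec n"
  shows "(A *\<^sub>v v) \<bullet>c w = v \<bullet>c (mat_adjoint A *\<^sub>v w)"
proof -
  have "(A *\<^sub>v v) \<bullet>c w = (\<Sum>i<n. \<Sum>j<m. A $$ (i, j) * v $ j * cnj (w $ i))"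
    using assms by (simp add: scalar_prod_def atLeast0LessThan sum_distrib_right)
  also have "\<dots> = (\<Sum>j<m. \<Sum>i<n. A $$ (i, j) * v $ j * cnj (w $ i))"
    by (rule sum.swap)
  also have "\<dots> = v \<bullet>c (mat_adjoint A *\<^sub>v w)"
    using assms by (simp add: scalar_prod_def atLeast0LessThan sum_distrib_left mult_ac)
  finally show ?thesis .
qed

lemma nonneg_hermitianD:
  assumes "nonneg_hermitian A" "A \<in> carrier_mat n n"
  shows "mat_adjoint A = A" "v \<in> carrier_vec n \<Longrightarrow> 0 \<le> Re ((A *\<^sub>v v) \<bullet>c v)"
  using assms by (auto simp: nonneg_hermitian_def)

text \<open>
  With \<open>w = M v\<close>, the form at \<open>v + t w\<close> equals \<open>2 t b + t\<^sup>2 c\<close>, where \<open>b = \<parallel>w\<parallel>\<^sup>2\<close> and \<open>c\<close> is the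
  form at \<open>w\<close>.  It is nonnegative for all real \<open>t\<close>, which forces \<open>b = 0\<close>.
\<close>
lemma nonneg_hermitian_null_vector:
  assumes psd: "nonneg_hermitian M" and M: "M \<in> carrier_mat n n" and v: "v \<in> carrier_vec n"
    and null: "Re ((M *\<^sub>v v) \<bullet>c v) = 0"
  shows "M *\<^sub>v v = 0\<^sub>v n"
proof -
  define w where "w = M *\<^sub>v v"
  have w: "w \<in> carrier_vec n" using M v by (simp add: w_def)
  define b where "b = Re (w \<bullet>c w)"
  define c where "c = Re ((M *\<^sub>v w) \<bullet>c w)"
  have b0: "b \<ge> 0"
    using conjugate_square_ge_0_vec[of w] by (simp add: b_def less_eq_complex_def)
  have c0: "c \<ge> 0" unfolding c_def using nonneg_hermitianD(2)[OF psd M w] .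
  have Mwv: "(M *\<^sub>v w) \<bullet>c v = w \<bullet>c w"
    using scalar_prod_adjoint[OF M w v] nonneg_hermitianD(1)[OF psd M] by (simp add: w_def)
  have ineq: "0 \<le> 2 * t * b + t\<^sup>2 * c" for t :: real
  proof -
    let ?t = "complex_of_real t"
    let ?x = "v + ?t \<cdot>\<^sub>v w"
    have x: "?x \<in> carrier_vec n" using v w by simp
    have Mw: "M *\<^sub>v w \<in> carrier_vec n" using M w by simp
    have Mx: "M *\<^sub>v ?x = w + ?t \<cdot>\<^sub>v (M *\<^sub>v w)"
      using M v w by (simp add: mult_add_distrib_mat_vec[of M n n] mult_mat_vec w_def)
    have cx: "conjugate ?x = conjugate v + ?t \<cdot>\<^sub>v conjugate w"
      using v w by (simp add: conjugate_add_vec[of _ n] conjugate_smult_vec)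
    have "(M *\<^sub>v ?x) \<bullet>c ?x = w \<bullet>c v + ?t * (w \<bullet>c w) + (?t * ((M *\<^sub>v w) \<bullet>c v) + ?t * (?t * ((M *\<^sub>v w) \<bullet>c w)))"
      unfolding Mx cx using v w Mw
      by (simp add: add_scalar_prod_distrib[of _ n] scalar_prod_add_distrib[of _ n] algebra_simps)
    also have "Re \<dots> = 2 * t * b + t\<^sup>2 * c"
      using null by (simp add: Mwv b_def c_def w_def[symmetric] power2_eq_square)
    finally show ?thesis using nonneg_hermitianD(2)[OF psd M x] by simp
  qed
  have "b = 0"
  proof (rule ccontr)
    assume "b \<noteq> 0"
    hence b: "b > 0" using b0 by simp
    \<comment> \<open>Near \<open>t = 0\<close> the linear term wins: \<open>t = - b / (c + 1)\<close> is small enough,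
      and the shift by \<open>1\<close> also covers \<open>c = 0\<close>.\<close>
    define d where "d = c + 1"
    have d: "d > 0" and c: "c = d - 1" using c0 by (simp_all add: d_def)
    have "0 \<le> 2 * (- b / d) * b + (- b / d)\<^sup>2 * c" by (rule ineq)
    also have "\<dots> = - ((b / d)\<^sup>2 * (d + 1))"
      unfolding c using d by (simp add: field_simps power2_eq_square)
    also have "\<dots> < 0" using b d by simp
    finally show False by simp
  qed
  moreover have "w \<bullet>c w = of_real b"
    using conjugate_square_ge_0_vec[of w] by (simp add: b_def less_eq_complex_def complex_eq_iff)
  ultimately show ?thesis using conjugate_square_eq_0_vec[OF w] by (simp add: w_def)
qed

context
  fixes A B C D :: "complex mat" and n m :: nat
  assumes A: "A \<in> carrier_mat n n" and B: "B \<in> carrier_mat n m"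
    and C: "C \<in> carrier_mat m n" and D: "D \<in> carrier_mat m m"
    and psd: "nonneg_hermitian (four_block_mat A B C D)"
begin

lemma four_block_adjoint: "mat_adjoint A = A" "mat_adjoint B = C"
proof -
  have h: "mat_adjoint (four_block_mat A B C D) = four_block_mat A B C D"
    using psd by (simp add: nonneg_hermitian_def)
  note ix = arg_cong[OF h, of "\<lambda>M. M $$ (i, j)" for i j]
  show "mat_adjoint A = A"
  proof (rule eq_matI)
    fix i j assume "i < dim_row A" "j < dim_col A"
    thus "mat_adjoint A $$ (i, j) = A $$ (i, j)"
      using ix[of i j] A B C D by simp
  qed (use A in auto)
  show "mat_adjoint B = C"
  proof (rule eq_matI)
    fix i j assume "i < dim_row C" "j < dim_col C"
    thus "mat_adjoint B $$ (i, j) = C $$ (i, j)"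
      using ix[of "n + i" j] A B C D by simp
  qed (use B C in auto)
qed

lemma four_block_padded:
  assumes v: "v \<in> carrier_vec n"
  shows "four_block_mat A B C D *\<^sub>v (v @\<^sub>v 0\<^sub>v m) = (A *\<^sub>v v) @\<^sub>v (C *\<^sub>v v)"
    "(four_block_mat A B C D *\<^sub>v (v @\<^sub>v 0\<^sub>v m)) \<bullet>c (v @\<^sub>v 0\<^sub>v m) = (A *\<^sub>v v) \<bullet>c v"
proof -
  show 1: "four_block_mat A B C D *\<^sub>v (v @\<^sub>v 0\<^sub>v m) = (A *\<^sub>v v) @\<^sub>v (C *\<^sub>v v)"
  proof -
    have "B *\<^sub>v 0\<^sub>v m = 0\<^sub>v n" "D *\<^sub>v 0\<^sub>v m = 0\<^sub>v m" using B D by (auto intro!: eq_vecI)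
    thus ?thesis using A C v by (simp add: four_block_mat_mult_vec[OF A B C D v zero_carrier_vec])
  qed
  have "conjugate (v @\<^sub>v 0\<^sub>v m) = conjugate v @\<^sub>v (0\<^sub>v m :: complex vec)"
    by (intro eq_vecI) auto
  thus "(four_block_mat A B C D *\<^sub>v (v @\<^sub>v 0\<^sub>v m)) \<bullet>c (v @\<^sub>v 0\<^sub>v m) = (A *\<^sub>v v) \<bullet>c v"
    unfolding 1 using A C v by (simp add: scalar_prod_append[of _ n _ m])
qed

lemma four_block_nonneg_left_upper: "nonneg_hermitian A"
  unfolding nonneg_hermitian_def
proof (intro conjI ballI)
  show "square_mat A" using A by auto
  show "mat_adjoint A = A" by (rule four_block_adjoint)
  fix v :: "complex vec" assume "v \<in> carrier_vec (dim_row A)"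
  hence v: "v \<in> carrier_vec n" using A by simp
  have "0 \<le> Re ((four_block_mat A B C D *\<^sub>v (v @\<^sub>v 0\<^sub>v m)) \<bullet>c (v @\<^sub>v 0\<^sub>v m))"
    using A D v by (intro nonneg_hermitianD(2)[OF psd, of "n + m"]) auto
  thus "0 \<le> Re ((A *\<^sub>v v) \<bullet>c v)" by (simp only: four_block_padded(2)[OF v])
qed

text \<open>
  In a positive semidefinite block matrix the off-diagonal block has its range inside that of the
  corner: a null vector \<open>v\<close> of \<open>A\<close>, padded by zeros, is a null vector of the quadratic form, hence of
  the whole matrix, so \<open>C v = 0\<close>.  Applied to the columns of the projection \<open>W\<close> onto the kernel of
  \<open>A\<close> this says \<open>C W = 0\<close>, and taking adjoints \<open>W B = 0\<close>.
\<close>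
lemma four_block_range_inclusion: "A * (mp_inverse A * B) = B"
proof -
  note X = mp_inverse[OF A]
  note [simp] = carrier_matD[OF A] carrier_matD[OF B] carrier_matD[OF C] carrier_matD[OF X(1)]
  define P where "P = A * mp_inverse A"
  have [simp]: "dim_row P = n" "dim_col P = n" by (simp_all add: P_def)
  have adjP: "mat_adjoint P = P" using X(4) by (simp add: P_def)
  have PA: "P * A = A" using X(2) by (simp add: P_def)
  have AP: "A * P = A"
    using arg_cong[OF PA, of mat_adjoint] by (simp add: mat_adjoint_mult_dim adjP four_block_adjoint)
  define W where "W = 1\<^sub>m n - P"
  have W: "W \<in> carrier_mat n n" by (simp add: W_def carrier_matI)
  have "A * W = 0\<^sub>m n n"
    using A by (simp add: W_def mat_dim_simps AP)
  have CW: "C * W = 0\<^sub>m m n"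
  proof (rule eq_matI)
    fix i j assume "i < dim_row (0\<^sub>m m n :: complex mat)" "j < dim_col (0\<^sub>m m n :: complex mat)"
    hence i: "i < m" and j: "j < n" by auto
    define v where "v = col W j"
    have v: "v \<in> carrier_vec n" using W j by (simp add: v_def)
    have Av: "A *\<^sub>v v = 0\<^sub>v n"
      unfolding v_def col_mult2[OF A W j, symmetric] \<open>A * W = 0\<^sub>m n n\<close> using j by (intro eq_vecI) auto
    have "four_block_mat A B C D *\<^sub>v (v @\<^sub>v 0\<^sub>v m) = 0\<^sub>v (n + m)"
    proof (rule nonneg_hermitian_null_vector[OF psd four_block_carrier_mat[OF A D]])
      show "v @\<^sub>v 0\<^sub>v m \<in> carrier_vec (n + m)" using v by simp
      show "Re ((four_block_mat A B C D *\<^sub>v (v @\<^sub>v 0\<^sub>v m)) \<bullet>c (v @\<^sub>v 0\<^sub>v m)) = 0"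
        unfolding four_block_padded(2)[OF v] Av using v by simp
    qed
    hence *: "(A *\<^sub>v v) @\<^sub>v (C *\<^sub>v v) = 0\<^sub>v (n + m)" by (simp only: four_block_padded(1)[OF v])
    have "(C *\<^sub>v v) $ i = 0"
      using arg_cong[OF *, of "\<lambda>x. x $ (n + i)"] i by simp
    thus "(C * W) $$ (i, j) = 0\<^sub>m m n $$ (i, j)"
      using C W i j by (simp add: v_def)
  qed (use W in auto)
  have "W * B = mat_adjoint (C * W)"
    using W by (simp add: mat_adjoint_mult_dim W_def mat_adjoint_minus[of _ n n] adjP carrier_matI
        flip: four_block_adjoint)
  hence "W * B = 0\<^sub>m n m" by (simp add: CW)
  hence "B - P * B = 0\<^sub>m n m"
    using B by (simp add: W_def mat_dim_simps)
  hence "B = P * B" using minus_mat_eq_0_iff[of B n m "P * B"] B by (simp add: carrier_matI)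
  thus ?thesis by (simp add: P_def mat_dim_simps)
qed

end

section \<open>Block Hankel matrices\<close>

lemma block_hankel_carrier [simp]:
  "block_hankel q s n \<in> carrier_mat ((n + 1) * q) ((n + 1) * q)"
  unfolding block_hankel_def by (rule block_mat_carrier)

lemma mat_adjoint_block_hankel:
  assumes "\<And>j. j \<le> 2 * n \<Longrightarrow> s j \<in> carrier_mat q q"
  shows "mat_adjoint (block_hankel q s n) = block_hankel q (\<lambda>j. mat_adjoint (s j)) n"
  unfolding block_hankel_def using assms
  by (subst mat_adjoint_block_mat) (auto simp: add.commute intro!: block_mat_eqI)

lemma block_hankel_hermitian_iff:
  assumes "\<And>j. j \<le> 2 * n \<Longrightarrow> s j \<in> carrier_mat q q"
  shows "mat_adjoint (block_hankel q s n) = block_hankel q s n \<longleftrightarrow>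
           (\<forall>j \<le> 2 * n. mat_adjoint (s j) = s j)"
proof -
  have adj: "mat_adjoint (block_hankel q s n) = block_hankel q (\<lambda>j. mat_adjoint (s j)) n"
    using assms by (rule mat_adjoint_block_hankel)
  show ?thesis
  proof
    assume *: "mat_adjoint (block_hankel q s n) = block_hankel q s n"
    show "\<forall>j \<le> 2 * n. mat_adjoint (s j) = s j"
    proof (intro allI impI)
      fix j assume j: "j \<le> 2 * n"
      define a b where "a = min j n" and "b = j - min j n"
      have ab: "j = a + b" "a < n + 1" "b < n + 1" using j by (auto simp: a_def b_def)
      have "block_mat q (n + 1) (n + 1) (\<lambda>j k. mat_adjoint (s (j + k))) = block_mat q (n + 1) (n + 1) (\<lambda>j k. s (j + k))"
        using * unfolding adj unfolding block_hankel_def .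
      from block_mat_eq_D[OF this ab(2,3)] show "mat_adjoint (s j) = s j"
        using ab(1) assms[OF j] by simp
    qed
  next
    assume "\<forall>j \<le> 2 * n. mat_adjoint (s j) = s j"
    hence "block_hankel q (\<lambda>j. mat_adjoint (s j)) n = block_hankel q s n"
      unfolding block_hankel_def by (intro block_mat_eqI) auto
    thus "mat_adjoint (block_hankel q s n) = block_hankel q s n"
      by (simp only: adj)
  qed
qed

text \<open>
  The bordering which exhibits \<open>L\<^bsub>n+1\<^esub>\<close> as a Schur complement in \<open>H\<^bsub>n+1\<^esub>\<close>.
\<close>
lemma block_hankel_Suc:
  assumes "s (2 * Suc n) \<in> carrier_mat q q"
  shows "block_hankel q s (Suc n) =
    four_block_mat (block_hankel q s n) (block_mat q (Suc n) 1 (\<lambda>j k. s (Suc n + j)))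
      (block_mat q 1 (Suc n) (\<lambda>j k. s (Suc n + k))) (s (2 * Suc n))"
    (is "?H = ?F")
proof (rule eq_matI)
  have dims: "dim_row (s (2 * Suc n)) = q" "dim_col (s (2 * Suc n)) = q" using assms by auto
  show "dim_row ?H = dim_row ?F" "dim_col ?H = dim_col ?F"
    using dims by (auto simp: block_hankel_def)
  fix i l assume "i < dim_row ?F" "l < dim_col ?F"
  hence i: "i < Suc n * q + q" and l: "l < Suc n * q + q"
    using dims by (simp_all add: block_hankel_def)
  have top: "x div q < Suc n" "x mod q < q" if "x < Suc n * q" for x
    using block_index_div_mod[OF that] by auto
  have bot: "x div q = Suc n" "x mod q = x - Suc n * q" if "x < Suc n * q + q" "\<not> x < Suc n * q" for x
  proof -
    define y where "y = x - Suc n * q"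
    have x: "x = y + Suc n * q" and y: "y < q" using that unfolding y_def by linarith+
    show "x div q = Suc n" "x mod q = x - Suc n * q"
      unfolding x using y by (simp_all only: div_mult_self3 mod_mult_self1 div_less mod_less add_diff_cancel_right')
        (simp_all add: div_add1_eq)
  qed
  have H: "?H $$ (i, l) = s (i div q + l div q) $$ (i mod q, l mod q)"
    using i l by (simp add: block_hankel_def block_mat_def)
  show "?H $$ (i, l) = ?F $$ (i, l)"
    unfolding H using i l dims top[of i] top[of l] bot[of i] bot[of l]
    by (cases "i < Suc n * q"; cases "l < Suc n * q")
       (simp_all add: block_hankel_def block_mat_def add.commute mult_2)
qed

lemma block_hankel_nonneg_Suc:
  assumes "nonneg_hermitian (block_hankel q s (Suc n))" "s (2 * Suc n) \<in> carrier_mat q q"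
  shows "nonneg_hermitian (block_hankel q s n)"
proof (rule four_block_nonneg_left_upper)
  show "block_hankel q s n \<in> carrier_mat ((n + 1) * q) ((n + 1) * q)" by (rule block_hankel_carrier)
  show "s (2 * Suc n) \<in> carrier_mat q q" by (rule assms(2))
  show "nonneg_hermitian (four_block_mat (block_hankel q s n) (block_mat q (Suc n) 1 (\<lambda>j k. s (Suc n + j)))
      (block_mat q 1 (Suc n) (\<lambda>j k. s (Suc n + k))) (s (2 * Suc n)))"
    using assms(1) by (simp only: block_hankel_Suc[of s n q, OF assms(2)])
qed (simp_all add: carrier_matI)

lemma block_hankel_nonneg_mono:
  assumes "nonneg_hermitian (block_hankel q s n)" "\<And>j. j \<le> 2 * n \<Longrightarrow> s j \<in> carrier_mat q q" "k \<le> n"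
  shows "nonneg_hermitian (block_hankel q s k)"
  using assms
proof (induction n)
  case (Suc n)
  show ?case
  proof (cases "k = Suc n")
    case False
    have "nonneg_hermitian (block_hankel q s n)"
      by (rule block_hankel_nonneg_Suc[OF Suc.prems(1)]) (rule Suc.prems(2), simp)
    thus ?thesis using Suc.prems False by (intro Suc.IH) simp_all
  next
    case True
    thus ?thesis using Suc.prems(1) by simp
  qed
qed simp

section \<open>Schur complements as Pade remainders\<close>

text \<open>
  The coefficient at \<open>z\<^sup>i\<close> in the product of the generating functions, summed in the order that
  the recursion for the reciprocal sequence uses.
\<close>
definition conv :: "nat \<Rightarrow> (nat \<Rightarrow> complex mat) \<Rightarrow> (nat \<Rightarrow> complex mat) \<Rightarrow> nat \<Rightarrow> complex mat" where
  "conv q s r i = mat_sum q (\<lambda>l. s (i - l) * r l) (Suc i)"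

lemma conv_cong:
  assumes "\<And>j. j \<le> i \<Longrightarrow> s j = s' j" "\<And>j. j \<le> i \<Longrightarrow> r j = r' j"
  shows "conv q s r i = conv q s' r' i"
  unfolding conv_def by (rule mat_sum_cong) (auto simp: assms)

text \<open>
  The polynomial \<open>R(z) = \<Sum> r\<^sub>l z\<^sup>l\<close> is a normalized right Pade denominator of order \<open>n\<close> for
  \<open>S(z)\<close>: the coefficients of \<open>S R\<close> at \<open>n, \<dots>, 2n - 1\<close> vanish.  The block column with entries
  \<open>r\<^sub>n, \<dots>, r\<^sub>0\<close> is then mapped by \<open>H\<^sub>n\<close> to a column that vanishes outside its last block.
\<close>
definition pade_denominator :: "nat \<Rightarrow> (nat \<Rightarrow> complex mat) \<Rightarrow> nat \<Rightarrow> (nat \<Rightarrow> complex mat) \<Rightarrow> bool" where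
  "pade_denominator q s n r \<longleftrightarrow>
     (\<forall>l. r l \<in> carrier_mat q q) \<and> r 0 = 1\<^sub>m q \<and> (\<forall>l>n. r l = 0\<^sub>m q q) \<and>
     (\<forall>i. n \<le> i \<and> i < 2 * n \<longrightarrow> conv q s r i = 0\<^sub>m q q)"

text \<open>
  Reading the coefficients of \<open>R\<close> backwards turns the convolution into a block row of a Hankel matrix.
\<close>
lemma conv_polynomial:
  assumes s: "\<And>j. j \<le> n + i \<Longrightarrow> s j \<in> carrier_mat q q"
    and r: "\<And>l. r l \<in> carrier_mat q q" "r 0 = 1\<^sub>m q" "\<And>l. l > n \<Longrightarrow> r l = 0\<^sub>m q q"
  shows "conv q s r (n + i) = s (n + i) + mat_sum q (\<lambda>k. s (i + k) * r (n - k)) n"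
proof (rule eq_matI)
  fix a b assume "a < dim_row (s (n + i) + mat_sum q (\<lambda>k. s (i + k) * r (n - k)) n)"
    "b < dim_col (s (n + i) + mat_sum q (\<lambda>k. s (i + k) * r (n - k)) n)"
  hence a: "a < q" and b: "b < q" by auto
  define x where "x = (\<lambda>l. (s (n + i - l) * r l) $$ (a, b))"
  have x0: "x 0 = s (n + i) $$ (a, b)"
    using s[of "n + i"] by (simp add: x_def r)
  have xn: "x l = 0" if "l > n" "l \<le> n + i" for l
  proof -
    have "s (n + i - l) * 0\<^sub>m q q = 0\<^sub>m q q" using s[of "n + i - l"] by (intro right_mult_zero_mat) simp
    thus ?thesis using that a b by (simp add: x_def r)
  qed
  have "conv q s r (n + i) $$ (a, b) = (\<Sum>l<Suc (n + i). x l)"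
    using a b by (simp add: conv_def mat_sum_index x_def)
  also have "\<dots> = (\<Sum>l<Suc n. x l)"
    using xn by (intro sum.mono_neutral_right) auto
  also have "\<dots> = x 0 + (\<Sum>l<n. x (Suc l))"
    by (rule sum.lessThan_Suc_shift)
  also have "(\<Sum>l<n. x (Suc l)) = (\<Sum>k<n. x (Suc (n - Suc k)))"
    by (rule sum.nat_diff_reindex[symmetric])
  also have "\<dots> = (\<Sum>k<n. (s (i + k) * r (n - k)) $$ (a, b))"
    by (intro sum.cong refl) (auto simp: x_def Suc_diff_Suc intro!: arg_cong2[of _ _ _ _ "\<lambda>j l. (s j * r l) $$ (a, b)"])
  finally show "conv q s r (n + i) $$ (a, b) = (s (n + i) + mat_sum q (\<lambda>k. s (i + k) * r (n - k)) n) $$ (a, b)"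
    using a b by (simp add: x0 mat_sum_index)
qed (auto simp: conv_def)

text \<open>
  Here \<open>Y\<^sup>* H\<^sup>\<dagger> Y = Z\<^sup>* H H\<^sup>\<dagger> H Z = Z\<^sup>* H Z\<close>, so the Schur complement can be computed from any
  solution of the linear system instead of the Moore--Penrose inverse.
\<close>
lemma schur_complement_eq:
  fixes H Y Z :: "complex mat"
  assumes H: "H \<in> carrier_mat n n" "mat_adjoint H = H"
    and Y: "Y \<in> carrier_mat n m" and Z: "Z \<in> carrier_mat n m" and HZ: "H * Z = - Y"
  shows "mat_adjoint Y * mp_inverse H * Y = - (mat_adjoint Y * Z)"
proof -
  note X = mp_inverse[OF H(1)]
  note [simp] = carrier_matD[OF H(1)] carrier_matD[OF Y] carrier_matD[OF Z] carrier_matD[OF X(1)]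
  have Y': "Y = - (H * Z)" using HZ by simp
  have adjY: "mat_adjoint Y = - (mat_adjoint Z * H)"
  proof -
    have "mat_adjoint Y = - mat_adjoint (H * Z)" unfolding Y' by (intro eq_matI) auto
    thus ?thesis by (simp add: mat_adjoint_mult_dim H)
  qed
  have "mat_adjoint Y * mp_inverse H * Y = mat_adjoint Z * (H * mp_inverse H * H * Z)"
    unfolding adjY unfolding Y' by (simp add: mat_dim_simps)
  also have "\<dots> = - (mat_adjoint Y * Z)"
    unfolding X(2) adjY by (simp add: mat_dim_simps)
  finally show ?thesis .
qed

lemma add_eq_0_mat_iff:
  fixes A B :: "'a :: ab_group_add mat"
  assumes "A \<in> carrier_mat n m" "B \<in> carrier_mat n m"
  shows "A + B = 0\<^sub>m n m \<longleftrightarrow> B = - A"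
proof
  assume *: "A + B = 0\<^sub>m n m"
  show "B = - A"
  proof (rule eq_matI)
    fix i j assume "i < dim_row (- A)" "j < dim_col (- A)"
    thus "B $$ (i, j) = (- A) $$ (i, j)"
      using arg_cong[OF *, of "\<lambda>M. M $$ (i, j)"] assms by (auto simp: add_eq_0_iff)
  qed (use assms in auto)
qed (use assms in auto)

text \<open>
  The block column \<open>Z\<close> with entries \<open>r\<^sub>n, \<dots>, r\<^sub>1\<close> solves \<open>H\<^bsub>n-1\<^esub> Z = - Y\<close>, where \<open>Y\<close> is the
  last block column, and the coefficient of \<open>S R\<close> at \<open>2n\<close> is \<open>s\<^bsub>2n\<^esub> + Y\<^sup>* Z\<close>.
\<close>
lemma schur_L_eq_conv:
  assumes s: "\<And>j. j \<le> 2 * n \<Longrightarrow> s j \<in> carrier_mat q q"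
    and herm: "\<And>j. j < 2 * n \<Longrightarrow> mat_adjoint (s j) = s j"
    and r: "pade_denominator q s n r"
  shows "schur_L q s n = conv q s r (2 * n)"
proof (cases "n = 0")
  case True
  thus ?thesis using r s[of 0] conv_polynomial[of 0 0 s q r]
    by (auto simp: schur_L_def pade_denominator_def mat_sum_def intro!: eq_matI)
next
  case False
  hence n: "n - 1 + 1 = n" by simp
  note rD = r[unfolded pade_denominator_def]
  have conv: "conv q s r (n + i) = s (n + i) + mat_sum q (\<lambda>k. s (i + k) * r (n - k)) n" if "i \<le> n" for i
    using rD that by (intro conv_polynomial s) auto
  define H where "H = block_mat q n n (\<lambda>j k. s (j + k))"
  define Y where "Y = block_mat q n 1 (\<lambda>j k. s (n + j))"
  define Z where "Z = block_mat q n 1 (\<lambda>k _. r (n - k))"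
  have H_eq: "H = block_hankel q s (n - 1)" unfolding block_hankel_def H_def n ..
  have adjY: "mat_adjoint Y = block_mat q 1 n (\<lambda>j k. s (n + k))"
    unfolding Y_def using s herm by (subst mat_adjoint_block_mat) (auto intro!: block_mat_eqI)
  have HZ: "H * Z = - Y"
  proof -
    have "H * Z = block_mat q n 1 (\<lambda>j k. mat_sum q (\<lambda>l. s (j + l) * r (n - l)) n)"
      unfolding H_def Z_def using s rD by (intro block_mat_mult) auto
    also have "\<dots> = block_mat q n 1 (\<lambda>j k. - s (n + j))"
    proof (rule block_mat_eqI)
      fix j k assume "j < n" "k < (1::nat)"
      hence "s (n + j) + mat_sum q (\<lambda>l. s (j + l) * r (n - l)) n = 0\<^sub>m q q"
        using conv[of j] rD by simp
      thus "mat_sum q (\<lambda>l. s (j + l) * r (n - l)) n = - s (n + j)"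
        using s[of "n + j"] \<open>j < n\<close> by (subst (asm) add_eq_0_mat_iff[of _ q q]) auto
    qed
    also have "\<dots> = - Y"
    proof (rule eq_matI)
      fix i l assume "i < dim_row (- Y)" "l < dim_col (- Y)"
      hence il: "i < n * q" "l < q" by (simp_all add: Y_def)
      thus "block_mat q n 1 (\<lambda>j k. - s (n + j)) $$ (i, l) = (- Y) $$ (i, l)"
        using block_index_div_mod[OF il(1)] s[of "n + i div q"] by (simp add: Y_def block_mat_def)
    qed (auto simp: Y_def)
    finally show ?thesis .
  qed
  have YZ: "mat_adjoint Y * Z = mat_sum q (\<lambda>k. s (n + k) * r (n - k)) n"
  proof -
    have "mat_adjoint Y * Z = block_mat q 1 1 (\<lambda>j k. mat_sum q (\<lambda>l. s (n + l) * r (n - l)) n)"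
      unfolding adjY Z_def using s rD by (intro block_mat_mult) auto
    thus ?thesis by (simp only: block_mat_1_1[where B = "\<lambda>_ _. mat_sum q f n" for f] mat_sum_carrier)
  qed
  have "mat_adjoint H = H"
  proof -
    have "mat_adjoint (s j) = s j" if "j \<le> 2 * (n - 1)" for j
      using that False by (intro herm) linarith
    thus ?thesis unfolding H_eq using s by (subst block_hankel_hermitian_iff) auto
  qed
  hence *: "mat_adjoint Y * mp_inverse H * Y = - (mat_adjoint Y * Z)"
    using HZ by (intro schur_complement_eq[where n = "n * q" and m = q]) (simp_all add: H_def Y_def Z_def carrier_matI)
  have "schur_L q s n = s (2 * n) - mat_adjoint Y * mp_inverse H * Y"
    unfolding adjY H_eq unfolding schur_L_def Y_def using False by simp
  also have "\<dots> = s (n + n) + mat_sum q (\<lambda>k. s (n + k) * r (n - k)) n"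
    unfolding * YZ using s[of "n + n"] by (intro eq_matI) (auto simp: mult_2)
  also have "\<dots> = conv q s r (2 * n)"
    using conv[of n] by (simp add: mult_2)
  finally show ?thesis .
qed

text \<open>
  By the range inclusion the system \<open>H\<^bsub>n-1\<^esub> Z = Y\<close> is solvable; the blocks of \<open>- Z\<close>, read
  backwards and preceded by \<open>I\<close>, are the coefficients of a denominator.
\<close>
lemma pade_denominator_exists:
  assumes s: "\<And>j. j \<le> 2 * n \<Longrightarrow> s j \<in> carrier_mat q q"
    and psd: "nonneg_hermitian (block_hankel q s n)"
  shows "\<exists>r. pade_denominator q s n r"
proof (cases n)
  case 0
  thus ?thesis
    by (intro exI[of _ "\<lambda>l. if l = 0 then 1\<^sub>m q else 0\<^sub>m q q"]) (auto simp: pade_denominator_def)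
next
  case (Suc m)
  define H where "H = block_hankel q s m"
  define Y where "Y = block_mat q n 1 (\<lambda>j k. s (n + j))"
  have H_eq: "H = block_mat q n n (\<lambda>j k. s (j + k))"
    by (simp add: H_def block_hankel_def Suc)
  have H: "H \<in> carrier_mat (n * q) (n * q)" unfolding H_eq by (rule block_mat_carrier)
  have Y: "Y \<in> carrier_mat (n * q) q" by (simp add: Y_def carrier_matI)
  have "H * (mp_inverse H * Y) = Y"
  proof (rule four_block_range_inclusion[OF H Y])
    show "block_mat q 1 n (\<lambda>j k. s (n + k)) \<in> carrier_mat q (n * q)" by (simp add: carrier_matI)
    show "s (2 * n) \<in> carrier_mat q q" by (simp add: s)
    show "nonneg_hermitian (four_block_mat H Y (block_mat q 1 n (\<lambda>j k. s (n + k))) (s (2 * n)))"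
      using psd s[of "2 * n"] by (simp add: Suc block_hankel_Suc H_def Y_def del: mult_Suc_right)
  qed
  moreover define Z where "Z = mp_inverse H * Y"
  ultimately have HZ: "H * Z = Y" by simp
  have Zc: "Z \<in> carrier_mat (n * q) (1 * q)" using Y mp_inverse(1)[OF H] by (simp add: Z_def)
  define z where "z = (\<lambda>k. mat q q (\<lambda>(a, b). Z $$ (k * q + a, 0 * q + b)))"
  have z: "z k \<in> carrier_mat q q" for k by (simp add: z_def)
  have Zz: "Z = block_mat q n 1 (\<lambda>k _. z k)"
    by (subst block_mat_blocks[OF Zc, symmetric]) (intro block_mat_eqI, auto simp: z_def)
  have eq: "mat_sum q (\<lambda>k. s (j + k) * z k) n = s (n + j)" if j: "j < n" for j
  proof -
    have "block_mat q n 1 (\<lambda>j _. mat_sum q (\<lambda>k. s (j + k) * z k) n) = H * Z"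
      unfolding Zz H_eq using s z by (subst block_mat_mult) auto
    also have "\<dots> = block_mat q n 1 (\<lambda>j _. s (n + j))" unfolding HZ Y_def ..
    finally show ?thesis
      by (rule block_mat_eq_D[where k = 0]) (use j s in auto)
  qed
  define r where "r = (\<lambda>l. if l = 0 then 1\<^sub>m q else if l \<le> n then - z (n - l) else 0\<^sub>m q q)"
  have r: "r l \<in> carrier_mat q q" "r 0 = 1\<^sub>m q" "l > n \<Longrightarrow> r l = 0\<^sub>m q q" for l
    using z by (auto simp: r_def)
  have "conv q s r i = 0\<^sub>m q q" if "n \<le> i" "i < 2 * n" for i
  proof -
    define j where "j = i - n"
    have i: "i = n + j" and j: "j < n" using that by (auto simp: j_def)
    have "mat_sum q (\<lambda>k. s (j + k) * r (n - k)) n = - mat_sum q (\<lambda>k. s (j + k) * z k) n"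
    proof (rule eq_matI)
      fix a b assume "a < dim_row (- mat_sum q (\<lambda>k. s (j + k) * z k) n)"
        "b < dim_col (- mat_sum q (\<lambda>k. s (j + k) * z k) n)"
      hence ab: "a < q" "b < q" by auto
      have "(s (j + k) * r (n - k)) $$ (a, b) = - ((s (j + k) * z k) $$ (a, b))" if "k < n" for k
      proof -
        have c: "s (j + k) \<in> carrier_mat q q" "z k \<in> carrier_mat q q" using s z j that by auto
        have "r (n - k) = - z k" using that by (simp add: r_def)
        moreover have "s (j + k) * - z k = - (s (j + k) * z k)" using c by simp
        ultimately show ?thesis using c ab by simp
      qed
      thus "mat_sum q (\<lambda>k. s (j + k) * r (n - k)) n $$ (a, b) = (- mat_sum q (\<lambda>k. s (j + k) * z k) n) $$ (a, b)"
        using ab by (simp add: mat_sum_index sum_negf)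
    qed auto
    also have "\<dots> = - s (n + j)" by (simp only: eq[OF j])
    finally have "conv q s r i = s (n + j) + - s (n + j)"
      unfolding i using s r j by (subst conv_polynomial) auto
    thus ?thesis using s[of "n + j"] j by (intro eq_matI) auto
  qed
  thus ?thesis using r unfolding pade_denominator_def by (intro exI[of _ r]) auto
qed

section \<open>Matrices of power series\<close>

definition gen_fun :: "nat \<Rightarrow> (nat \<Rightarrow> complex mat) \<Rightarrow> complex fps mat" where
  "gen_fun q s = mat q q (\<lambda>(a, b). Abs_fps (\<lambda>j. s j $$ (a, b)))"

definition mat_coeff :: "complex fps mat \<Rightarrow> nat \<Rightarrow> complex mat" where
  "mat_coeff M j = map_mat (\<lambda>f. fps_nth f j) M"

abbreviation const_mat :: "complex mat \<Rightarrow> complex fps mat" where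
  "const_mat \<equiv> map_mat fps_const"

lemma gen_fun_dim [simp]: "dim_row (gen_fun q s) = q" "dim_col (gen_fun q s) = q"
  by (simp_all add: gen_fun_def)

lemma mat_coeff_dim [simp]:
  "dim_row (mat_coeff M j) = dim_row M" "dim_col (mat_coeff M j) = dim_col M"
  by (simp_all add: mat_coeff_def)

lemma mat_coeff_index [simp]:
  "a < dim_row M \<Longrightarrow> b < dim_col M \<Longrightarrow> mat_coeff M j $$ (a, b) = fps_nth (M $$ (a, b)) j"
  by (simp add: mat_coeff_def)

lemma mat_coeff_gen_fun [simp]: "s j \<in> carrier_mat q q \<Longrightarrow> mat_coeff (gen_fun q s) j = s j"
  by (intro eq_matI) (auto simp: gen_fun_def)

lemma mat_coeff_eqI:
  assumes "dim_row A = dim_row B" "dim_col A = dim_col B" "\<And>j. mat_coeff A j = mat_coeff B j"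
  shows "A = B"
proof (rule eq_matI)
  fix a b assume "a < dim_row B" "b < dim_col B"
  thus "A $$ (a, b) = B $$ (a, b)"
    using assms(1,2) arg_cong[OF assms(3), of "\<lambda>M. M $$ (a, b)"] by (intro fps_ext) simp
qed (use assms in auto)

lemma mat_coeff_add [simp]:
  "dim_row A = dim_row B \<Longrightarrow> dim_col A = dim_col B \<Longrightarrow>
     mat_coeff (A + B) j = mat_coeff A j + mat_coeff B j"
  by (intro eq_matI) auto

lemma mat_coeff_minus [simp]:
  "dim_row A = dim_row B \<Longrightarrow> dim_col A = dim_col B \<Longrightarrow>
     mat_coeff (A - B) j = mat_coeff A j - mat_coeff B j"
  by (intro eq_matI) auto

lemma mat_coeff_shift [simp]:
  "mat_coeff (fps_X ^ k \<cdot>\<^sub>m A) j =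
     (if j < k then 0\<^sub>m (dim_row A) (dim_col A) else mat_coeff A (j - k))"
  by (intro eq_matI) (auto simp: fps_X_power_mult_nth)

lemma mat_coeff_X [simp]:
  "mat_coeff (fps_X \<cdot>\<^sub>m A) j = (if j = 0 then 0\<^sub>m (dim_row A) (dim_col A) else mat_coeff A (j - 1))"
  using mat_coeff_shift[of 1 A j] by simp

lemma mat_coeff_const [simp]:
  "mat_coeff (const_mat A) j = (if j = 0 then A else 0\<^sub>m (dim_row A) (dim_col A))"
  by (intro eq_matI) auto

lemma mat_coeff_mult:
  assumes [simp]: "dim_row A = q" "dim_col A = q" "dim_row B = q" "dim_col B = q"
  shows "mat_coeff (A * B) j = conv q (mat_coeff A) (mat_coeff B) j"
proof (rule eq_matI)
  fix a b assume "a < dim_row (conv q (mat_coeff A) (mat_coeff B) j)"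
    "b < dim_col (conv q (mat_coeff A) (mat_coeff B) j)"
  hence ab: "a < q" "b < q" by (simp_all add: conv_def)
  have "mat_coeff (A * B) j $$ (a, b) = fps_nth (\<Sum>c<q. A $$ (a, c) * B $$ (c, b)) j"
    using ab index_mult_mat_sum[of A q q B q a b] by (simp add: carrier_matI)
  also have "\<dots> = (\<Sum>c<q. \<Sum>l<Suc j. fps_nth (A $$ (a, c)) (j - l) * fps_nth (B $$ (c, b)) l)"
  proof -
    have "fps_nth (f * g) j = (\<Sum>l<Suc j. fps_nth f (j - l) * fps_nth g l)" for f g :: "complex fps"
      using fps_mult_nth[of g f j] by (simp add: mult.commute atLeast0AtMost lessThan_Suc_atMost)
    thus ?thesis by (simp add: fps_sum_nth)
  qed
  also have "\<dots> = (\<Sum>l<Suc j. \<Sum>c<q. fps_nth (A $$ (a, c)) (j - l) * fps_nth (B $$ (c, b)) l)"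
    by (rule sum.swap)
  also have "\<dots> = (\<Sum>l<Suc j. (mat_coeff A (j - l) * mat_coeff B l) $$ (a, b))"
    using ab index_mult_mat_sum[of "mat_coeff A _" q q "mat_coeff B _" q a b]
    by (intro sum.cong refl) (simp add: carrier_matI)
  also have "\<dots> = conv q (mat_coeff A) (mat_coeff B) j $$ (a, b)"
    using ab by (simp add: conv_def mat_sum_index)
  finally show "mat_coeff (A * B) j $$ (a, b) = conv q (mat_coeff A) (mat_coeff B) j $$ (a, b)" .
qed (simp_all add: conv_def)

lemma mat_coeff_const_mult:
  assumes "dim_col A = dim_row B"
  shows "mat_coeff (const_mat A * B) j = A * mat_coeff B j"
  using assms by (intro eq_matI) (auto simp: scalar_prod_def fps_sum_nth)

lemma mat_coeff_mult_const:
  assumes "dim_col B = dim_row A"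
  shows "mat_coeff (B * const_mat A) j = mat_coeff B j * A"
  using assms by (intro eq_matI) (auto simp: scalar_prod_def fps_sum_nth)

lemma mat_coeff_mult_0:
  assumes "dim_col A = dim_row B"
  shows "mat_coeff (A * B) 0 = mat_coeff A 0 * mat_coeff B 0"
  using assms by (intro eq_matI) (auto simp: scalar_prod_def fps_sum_nth)

lemma const_mat_mult:
  assumes "dim_col A = dim_row B"
  shows "const_mat A * const_mat B = const_mat (A * B)"
  using assms by (intro mat_coeff_eqI) (auto simp: mat_coeff_const_mult)

lemma smult_mult_mat_dim:
  fixes A :: "'a :: comm_ring_1 mat"
  assumes "dim_col A = dim_row B"
  shows "(k \<cdot>\<^sub>m A) * B = k \<cdot>\<^sub>m (A * B)" "A * (k \<cdot>\<^sub>m B) = k \<cdot>\<^sub>m (A * B)"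
  by (rule mult_smult_assoc_mat mult_smult_distrib; use assms in \<open>auto intro!: carrier_matI\<close>)+

lemma smult_add_mat_dim:
  fixes A :: "'a :: comm_ring_1 mat"
  assumes "dim_row A = dim_row B" "dim_col A = dim_col B"
  shows "k \<cdot>\<^sub>m (A + B) = k \<cdot>\<^sub>m A + k \<cdot>\<^sub>m B" "k \<cdot>\<^sub>m (A - B) = k \<cdot>\<^sub>m A - k \<cdot>\<^sub>m B"
  using assms by (auto intro!: eq_matI simp: algebra_simps)

lemma smult_smult_mat: 
  fixes A :: "'a :: comm_ring_1 mat"
  shows "k \<cdot>\<^sub>m (l \<cdot>\<^sub>m A) = (k * l) \<cdot>\<^sub>m A"
  by (intro eq_matI) (auto simp: mult.assoc)

lemmas fps_mat_simps = mat_dim_simps smult_mult_mat_dim smult_add_mat_dim smult_smult_mat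

lemma mat_sum_rev: "mat_sum q (\<lambda>l. f (n - l)) (Suc n) = mat_sum q f (Suc n)"
proof (rule eq_matI)
  fix a b assume "a < dim_row (mat_sum q f (Suc n))" "b < dim_col (mat_sum q f (Suc n))"
  thus "mat_sum q (\<lambda>l. f (n - l)) (Suc n) $$ (a, b) = mat_sum q f (Suc n) $$ (a, b)"
    using sum.nat_diff_reindex[of "\<lambda>l. f l $$ (a, b)" "Suc n"] by (simp only: mat_sum_index mat_sum_dim diff_Suc_Suc)
qed auto

lemma mat_adjoint_mat_sum:
  assumes "\<And>l. l < n \<Longrightarrow> f l \<in> carrier_mat q q"
  shows "mat_adjoint (mat_sum q f n) = mat_sum q (\<lambda>l. mat_adjoint (f l)) n"
proof (rule eq_matI)
  fix a b assume "a < dim_row (mat_sum q (\<lambda>l. mat_adjoint (f l)) n)" "b < dim_col (mat_sum q (\<lambda>l. mat_adjoint (f l)) n)"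
  hence ab: "a < q" "b < q" by auto
  have "cnj (f l $$ (b, a)) = mat_adjoint (f l) $$ (a, b)" if "l < n" for l
    using assms[OF that] ab by simp
  thus "mat_adjoint (mat_sum q f n) $$ (a, b) = mat_sum q (\<lambda>l. mat_adjoint (f l)) n $$ (a, b)"
    using ab by (simp add: mat_sum_index cnj_sum)
qed auto

lemma mult_mat_sum:
  assumes A: "A \<in> carrier_mat q q" and f: "\<And>l. l < n \<Longrightarrow> f l \<in> carrier_mat q q"
  shows "A * mat_sum q f n = mat_sum q (\<lambda>l. A * f l) n"
proof (rule eq_matI)
  fix a b assume "a < dim_row (mat_sum q (\<lambda>l. A * f l) n)" "b < dim_col (mat_sum q (\<lambda>l. A * f l) n)"
  hence ab: "a < q" "b < q" by auto
  have "(A * mat_sum q f n) $$ (a, b) = (\<Sum>c<q. \<Sum>l<n. A $$ (a, c) * f l $$ (c, b))"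
    using ab index_mult_mat_sum[OF A mat_sum_carrier ab] by (simp add: mat_sum_index sum_distrib_left)
  also have "\<dots> = (\<Sum>l<n. \<Sum>c<q. A $$ (a, c) * f l $$ (c, b))" by (rule sum.swap)
  also have "\<dots> = (\<Sum>l<n. (A * f l) $$ (a, b))"
    using f by (intro sum.cong refl index_mult_mat_sum[OF A _ ab, symmetric]) auto
  finally show "(A * mat_sum q f n) $$ (a, b) = mat_sum q (\<lambda>l. A * f l) n $$ (a, b)"
    using ab by (simp add: mat_sum_index)
qed (use A in auto)

text \<open>
  Treats the variable \<open>z\<close> as real; it is the coefficientwise form of the matrix adjoint.
\<close>
definition fps_mat_adjoint :: "nat \<Rightarrow> complex fps mat \<Rightarrow> complex fps mat" where
  "fps_mat_adjoint q M = gen_fun q (\<lambda>j. mat_adjoint (mat_coeff M j))"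

lemma fps_mat_adjoint_dim [simp]:
  "dim_row (fps_mat_adjoint q M) = q" "dim_col (fps_mat_adjoint q M) = q"
  by (simp_all add: fps_mat_adjoint_def)

lemma mat_coeff_adjoint:
  assumes "dim_row M = q" "dim_col M = q"
  shows "mat_coeff (fps_mat_adjoint q M) j = mat_adjoint (mat_coeff M j)"
  unfolding fps_mat_adjoint_def using assms by (intro mat_coeff_gen_fun carrier_matI) simp_all

lemma fps_mat_adjoint_eq_self:
  assumes "dim_row M = q" "dim_col M = q" "\<And>j. mat_adjoint (mat_coeff M j) = mat_coeff M j"
  shows "fps_mat_adjoint q M = M"
  by (rule mat_coeff_eqI) (simp_all add: assms mat_coeff_adjoint)

lemma fps_mat_adjoint_mult:
  assumes A: "dim_row A = q" "dim_col A = q" and B: "dim_row B = q" "dim_col B = q"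
  shows "fps_mat_adjoint q (A * B) = fps_mat_adjoint q B * fps_mat_adjoint q A"
proof (rule mat_coeff_eqI)
  fix j
  have "mat_coeff (fps_mat_adjoint q (A * B)) j =
          mat_sum q (\<lambda>l. mat_adjoint (mat_coeff A (j - l) * mat_coeff B l)) (Suc j)"
  proof -
    have "mat_coeff A (j - l) * mat_coeff B l \<in> carrier_mat q q" for l
      by (rule carrier_matI) (simp_all add: A B)
    thus ?thesis
      unfolding mat_coeff_mult[OF A B, symmetric]
      by (simp only: mat_coeff_adjoint[of "A * B" q] index_mult_mat A B mat_coeff_mult[OF A B] conv_def mat_adjoint_mat_sum)
  qed
  also have "\<dots> = mat_sum q (\<lambda>l. mat_adjoint (mat_coeff A (j - (j - l)) * mat_coeff B (j - l))) (Suc j)"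
    by (rule mat_sum_rev[symmetric])
  also have "\<dots> = mat_sum q (\<lambda>l. mat_adjoint (mat_coeff B (j - l)) * mat_adjoint (mat_coeff A l)) (Suc j)"
    using A B by (intro mat_sum_cong) (auto simp: mat_adjoint_mult_dim)
  also have "\<dots> = mat_coeff (fps_mat_adjoint q B * fps_mat_adjoint q A) j"
    using A B by (simp add: mat_coeff_mult[of _ q] conv_def mat_coeff_adjoint)
  finally show "mat_coeff (fps_mat_adjoint q (A * B)) j = mat_coeff (fps_mat_adjoint q B * fps_mat_adjoint q A) j" .
qed simp_all

text \<open>
  A series whose coefficients at \<open>n, \<dots>, k - 1\<close> vanish is a polynomial of degree less than \<open>n\<close> plus
  a multiple of \<open>z\<^sup>k\<close>, and both parts inherit the range of the series.
\<close>
lemma split_at_gap: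
  assumes [simp]: "dim_row M = q" "dim_col M = q"
    and gap: "\<And>i. n \<le> i \<Longrightarrow> i < k \<Longrightarrow> mat_coeff M i = 0\<^sub>m q q" and nk: "n \<le> k"
    and p: "dim_row p = q" "dim_col p = q" "const_mat p * M = M"
  obtains N \<Lambda> where "M = N + fps_X ^ k \<cdot>\<^sub>m \<Lambda>"
    "dim_row N = q" "dim_col N = q" "dim_row \<Lambda> = q" "dim_col \<Lambda> = q"
    "\<And>i. n \<le> i \<Longrightarrow> mat_coeff N i = 0\<^sub>m q q" "\<And>i. i < n \<Longrightarrow> mat_coeff N i = mat_coeff M i"
    "const_mat p * N = N" "mat_coeff \<Lambda> 0 = mat_coeff M k" "p * mat_coeff \<Lambda> 0 = mat_coeff \<Lambda> 0"
proof -
  define N where "N = gen_fun q (\<lambda>i. if i < n then mat_coeff M i else 0\<^sub>m q q)"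
  define L where "L = gen_fun q (\<lambda>i. mat_coeff M (i + k))"
  have N: "mat_coeff N i = (if i < n then mat_coeff M i else 0\<^sub>m q q)" for i
    unfolding N_def by (rule mat_coeff_gen_fun) (auto intro: carrier_matI)
  have L: "mat_coeff L i = mat_coeff M (i + k)" for i
    unfolding L_def by (rule mat_coeff_gen_fun) (auto intro: carrier_matI)
  have [simp]: "dim_row N = q" "dim_col N = q" "dim_row L = q" "dim_col L = q"
    by (simp_all add: N_def L_def)
  have pM: "p * mat_coeff M i = mat_coeff M i" for i
    using arg_cong[OF p(3), of "\<lambda>M. mat_coeff M i"] p(1,2) by (simp add: mat_coeff_const_mult)
  have p0: "p * 0\<^sub>m q q = 0\<^sub>m q q" using p(1,2) by (intro right_mult_zero_mat carrier_matI)
  show ?thesis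
  proof (rule that[of N L])
    show "M = N + fps_X ^ k \<cdot>\<^sub>m L"
    proof (rule mat_coeff_eqI)
      fix i
      have "mat_coeff M i \<in> carrier_mat q q" by (intro carrier_matI) simp_all
      thus "mat_coeff M i = mat_coeff (N + fps_X ^ k \<cdot>\<^sub>m L) i"
        using gap[of i] nk by (cases "i < n"; cases "i < k") (auto simp: N L)
    qed simp_all
    show "const_mat p * N = N"
      by (rule mat_coeff_eqI) (use p(1,2) in \<open>simp_all add: mat_coeff_const_mult N pM p0\<close>)
  qed (simp_all add: N L pM)
qed

section \<open>Generating functions of the transformed sequences\<close>

lemma mat_coeff_linear_factor:
  "mat_coeff ((1 - fps_const a * fps_X) \<cdot>\<^sub>m M) j =
     (- a) \<cdot>\<^sub>m (if j = 0 then 0\<^sub>m (dim_row M) (dim_col M) else mat_coeff M (j - 1)) + mat_coeff M j"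
proof -
  have "fps_nth ((1 - fps_const a * fps_X) * f) j = - a * (if j = 0 then 0 else fps_nth f (j - 1)) + fps_nth f j" for f :: "complex fps"
  proof -
    have "(1 - fps_const a * fps_X) * f = f - fps_const a * (fps_X * f)" by (simp add: algebra_simps)
    thus ?thesis by simp
  qed
  thus ?thesis by (intro eq_matI) auto
qed

lemma alpha_seq_carrier:
  assumes "s j \<in> carrier_mat q q" "s (j + 1) \<in> carrier_mat q q"
  shows "alpha_seq \<alpha> s j \<in> carrier_mat q q"
  using assms by (simp add: alpha_seq_def)

lemma gen_fun_plus_transform:
  assumes s: "\<And>j. s j \<in> carrier_mat q q"
  shows "gen_fun q (plus_transform q \<alpha> s) = (1 - fps_const (complex_of_real \<alpha>) * fps_X) \<cdot>\<^sub>m gen_fun q s"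
proof (rule mat_coeff_eqI)
  fix j
  have "plus_transform q \<alpha> s j \<in> carrier_mat q q" using s by (simp add: plus_transform_def)
  thus "mat_coeff (gen_fun q (plus_transform q \<alpha> s)) j =
     mat_coeff ((1 - fps_const (complex_of_real \<alpha>) * fps_X) \<cdot>\<^sub>m gen_fun q s) j"
    by (simp add: mat_coeff_linear_factor s plus_transform_def)
qed simp_all

lemma gen_fun_alpha_seq:
  assumes s: "\<And>j. s j \<in> carrier_mat q q"
  shows "(1 - fps_const (complex_of_real \<alpha>) * fps_X) \<cdot>\<^sub>m gen_fun q s =
           fps_X \<cdot>\<^sub>m gen_fun q (alpha_seq \<alpha> s) + const_mat (s 0)"
proof (rule mat_coeff_eqI)
  fix j
  note [simp] = carrier_matD[OF s]
  have a: "alpha_seq \<alpha> s i \<in> carrier_mat q q" for i using s by (simp add: alpha_seq_carrier)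
  show "mat_coeff ((1 - fps_const (complex_of_real \<alpha>) * fps_X) \<cdot>\<^sub>m gen_fun q s) j =
     mat_coeff (fps_X \<cdot>\<^sub>m gen_fun q (alpha_seq \<alpha> s) + const_mat (s 0)) j"
    using s[of 0] by (cases j) (simp_all add: mat_coeff_linear_factor s a alpha_seq_def)
qed (use carrier_matD[OF s] in simp_all)

text \<open>
  The setting of one Schur step for a possibly singular \<open>s\<^sub>0\<close>.  The matrix \<open>p\<close> is the orthogonal
  projection onto the range of \<open>s\<^sub>0\<close>, which contains the ranges of all \<open>s\<^sub>j\<close>.  The letters
  \<open>S\<close>, \<open>u\<close>, \<open>V\<close>, \<open>T\<close> stand for the generating functions of the sequence, of its \<open>[+,\<alpha>]\<close>-transform, of
  the reciprocal sequence of the latter, and of the first Schur transform.  The power series \<open>P\<close>, \<open>c0\<close>,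
  \<open>g\<close> are the constants \<open>p\<close>, \<open>s\<^sub>0\<close>, \<open>s\<^sub>0\<^sup>\<dagger>\<close>.
\<close>
locale range_dominated_sequence =
  fixes q :: nat and \<alpha> :: real and s :: "nat \<Rightarrow> complex mat"
  assumes carrier: "s j \<in> carrier_mat q q"
    and hermitian: "mat_adjoint (s j) = s j"
    and dominated: "s 0 * mp_inverse (s 0) * s j = s j"
begin

abbreviation "p \<equiv> s 0 * mp_inverse (s 0)"
abbreviation "P \<equiv> const_mat p"
abbreviation "c0 \<equiv> const_mat (s 0)"
abbreviation "g \<equiv> const_mat (mp_inverse (s 0))"
abbreviation "S \<equiv> gen_fun q s"
abbreviation "c \<equiv> 1 - fps_const (complex_of_real \<alpha>) * fps_X"
abbreviation "u \<equiv> c \<cdot>\<^sub>m S"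
abbreviation "v \<equiv> reciprocal q (plus_transform q \<alpha> s)"
abbreviation "V \<equiv> gen_fun q v"
abbreviation "t \<equiv> schur_first q \<alpha> s"
abbreviation "T \<equiv> gen_fun q t"

lemma dims [simp]: "dim_row (s j) = q" "dim_col (s j) = q"
    "dim_row (mp_inverse (s 0)) = q" "dim_col (mp_inverse (s 0)) = q"
  using carrier[of j] mp_inverse(1)[OF carrier[of 0]] by auto

lemma p_facts:
  "p * s 0 = s 0" "s 0 * p = s 0" "p * mp_inverse (s 0) = mp_inverse (s 0)"
  "mp_inverse (s 0) * s 0 = p" "mat_adjoint p = p"
proof -
  note X = mp_inverse[OF carrier[of 0]] and Y = mp_inverse_hermitian[OF carrier[of 0] hermitian]
  show "p * s 0 = s 0" by (rule X)
  show gs: "mp_inverse (s 0) * s 0 = p" by (rule Y)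
  have "s 0 * (mp_inverse (s 0) * s 0) = s 0" using X(2) by (simp add: mat_dim_simps)
  thus "s 0 * p = s 0" by (simp only: gs)
  show "p * mp_inverse (s 0) = mp_inverse (s 0)" using X(3) by (simp flip: gs)
  show "mat_adjoint p = p" by (rule X)
qed

lemma plus_transform_0: "plus_transform q \<alpha> s 0 = s 0"
  using carrier[of 0] by (simp add: plus_transform_def)

lemma v_carrier [simp]: "v j \<in> carrier_mat q q"
  by (subst reciprocal.simps) (auto intro!: carrier_matI simp: plus_transform_0)

lemma mat_coeff_u: "mat_coeff u j = plus_transform q \<alpha> s j"
  by (simp add: gen_fun_plus_transform[OF carrier, symmetric] plus_transform_def carrier)

lemma plus_transform_carrier [simp]: "plus_transform q \<alpha> s j \<in> carrier_mat q q"
  using carrier by (simp add: plus_transform_def)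

lemma const_P: "c0 * g = P" "g * c0 = P" "P * c0 = c0" "c0 * P = c0"
  by (simp_all add: const_mat_mult p_facts)

lemma P_S: "P * S = S"
  by (rule mat_coeff_eqI) (simp_all add: mat_coeff_const_mult carrier dominated)

lemma P_u: "P * u = u"
  by (simp add: fps_mat_simps P_S)

lemma p_u: "p * plus_transform q \<alpha> s j = plus_transform q \<alpha> s j"
  using arg_cong[OF P_u, of "\<lambda>M. mat_coeff M j"]
  by (simp only: mat_coeff_u mat_coeff_const_mult[of p u] index_mult_mat dims gen_fun_dim index_smult_mat)

lemma P_V: "P * V = V"
proof (rule mat_coeff_eqI)
  fix j
  have "p * v j = v j"
  proof (cases "j = 0")
    case True
    thus ?thesis by (simp add: reciprocal.simps[of _ _ 0] plus_transform_0 p_facts)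
  next
    case False
    define w where "w = mat_sum q (\<lambda>l. plus_transform q \<alpha> s (j - l) * v l) j"
    have [simp]: "dim_row w = q" "dim_col w = q" by (simp_all add: w_def)
    have v: "v j = - (mp_inverse (s 0) * w)"
      by (subst reciprocal.simps) (simp add: False plus_transform_0 w_def)
    have "p * v j = - ((p * mp_inverse (s 0)) * w)"
      unfolding v by (simp add: mat_dim_simps)
    thus ?thesis unfolding p_facts v .
  qed
  thus "mat_coeff (P * V) j = mat_coeff V j"
    by (simp add: mat_coeff_const_mult)
qed simp_all

text \<open>
  The recursion for the reciprocal sequence says that each coefficient of \<open>u V\<close> after the first is
  \<open>w - p w\<close> for some sum \<open>w\<close> of terms whose range lies in that of \<open>s\<^sub>0\<close>.
\<close>
lemma u_V: "u * V = P"
proof (rule mat_coeff_eqI)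
  fix j
  have cu: "conv q (mat_coeff u) (mat_coeff V) j = conv q (plus_transform q \<alpha> s) v j"
    by (rule conv_cong) (simp_all add: mat_coeff_u)
  have "conv q (plus_transform q \<alpha> s) v j = (if j = 0 then p else 0\<^sub>m q q)"
  proof (cases "j = 0")
    case True
    have "conv q (plus_transform q \<alpha> s) v 0 = p"
      by (intro eq_matI) (auto simp: conv_def mat_sum_def reciprocal.simps[of _ _ 0] plus_transform_0)
    thus ?thesis using True by simp
  next
    case False
    define f where "f = (\<lambda>l. plus_transform q \<alpha> s (j - l) * v l)"
    define w where "w = mat_sum q f j"
    have f: "f l \<in> carrier_mat q q" for l
      unfolding f_def by (rule mult_carrier_mat[OF plus_transform_carrier v_carrier])
    have [simp]: "dim_row w = q" "dim_col w = q" by (simp_all add: w_def)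
    note [simp] = carrier_matD[OF f]
    have pf: "p * f l = f l" for l
    proof -
      have "p * f l = (p * plus_transform q \<alpha> s (j - l)) * v l"
        using carrier_matD[OF plus_transform_carrier[of "j - l"]] carrier_matD[OF v_carrier[of l]]
        by (simp add: f_def assoc_mult_mat_dim)
      thus ?thesis by (simp only: p_u f_def)
    qed
    have pc: "p \<in> carrier_mat q q" by (rule carrier_matI) simp_all
    have pw: "p * w = w"
      unfolding w_def by (subst mult_mat_sum[OF pc f]) (simp only: pf)
    have v: "v j = - (mp_inverse (s 0) * w)"
      by (subst reciprocal.simps) (simp add: False plus_transform_0 w_def f_def)
    have "conv q (plus_transform q \<alpha> s) v j = w + f j"
      unfolding conv_def w_def f_def[symmetric]
      by (intro eq_matI) (simp_all add: mat_sum_index)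
    also have "f j = - (p * w)"
      unfolding f_def v by (simp add: plus_transform_0 mat_dim_simps)
    also have "w + - (p * w) = 0\<^sub>m q q"
      unfolding pw by (intro eq_matI) auto
    finally show ?thesis using False by simp
  qed
  thus "mat_coeff (u * V) j = mat_coeff P j"
    using mat_coeff_mult[of u q V j] by (simp add: cu)
qed simp_all

lemma adjoint_u: "fps_mat_adjoint q u = u"
proof (rule fps_mat_adjoint_eq_self)
  fix j
  show "mat_adjoint (mat_coeff u j) = mat_coeff u j"
    unfolding mat_coeff_u plus_transform_def using carrier
    by (subst mat_adjoint_add[of _ q q]) (auto simp: mat_adjoint_smult hermitian)
qed simp_all

text \<open>
  The recursion only makes \<open>V\<close> a right inverse.  Its adjoint is a left inverse, and by the usual
  argument \<open>V\<^sup>* = V\<^sup>* P = V\<^sup>* u V = P V = V\<close> the two agree.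
\<close>
lemma adjoint_V: "fps_mat_adjoint q V = V" and V_u: "V * u = P"
proof -
  let ?W = "fps_mat_adjoint q V"
  have P: "fps_mat_adjoint q P = P"
    by (rule fps_mat_adjoint_eq_self) (simp_all add: p_facts del: index_mult_mat(1))
  have Wu: "?W * u = P"
    using arg_cong[OF u_V, of "fps_mat_adjoint q"] fps_mat_adjoint_mult[of u q V]
    by (simp add: adjoint_u P)
  have "?W = ?W * P"
    using arg_cong[OF P_V, of "fps_mat_adjoint q"] fps_mat_adjoint_mult[of P q V]
    by (simp add: P)
  also have "\<dots> = (?W * u) * V"
    by (simp only: u_V[symmetric]) (simp add: assoc_mult_mat_dim)
  also have "\<dots> = V" by (simp only: Wu P_V)
  finally show 1: "?W = V" .
  show "V * u = P" using Wu by (simp only: 1)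
qed

lemma mat_coeff_V_0: "mat_coeff V 0 = mp_inverse (s 0)"
proof -
  have "mat_coeff V 0 = v 0" by simp
  thus ?thesis by (simp add: reciprocal.simps[of _ _ 0] plus_transform_0)
qed

lemma adjoint_v: "mat_adjoint (v j) = v j"
  using arg_cong[OF adjoint_V, of "\<lambda>M. mat_coeff M j"] by (simp add: mat_coeff_adjoint)

lemma t_eq: "t j = - (s 0 * v (j + 1) * s 0)"
  using carrier_matD[OF v_carrier[of "j + 1"]] by (simp add: schur_first_def mat_dim_simps)

lemma t_carrier: "t j \<in> carrier_mat q q"
  unfolding t_eq by (intro uminus_carrier_mat mult_carrier_mat[OF _ carrier] mult_carrier_mat[OF carrier v_carrier])

lemma adjoint_t: "mat_adjoint (t j) = t j"
proof -
  have "mat_adjoint (t j) = - mat_adjoint (s 0 * v (j + 1) * s 0)"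
    unfolding t_eq by (intro eq_matI) auto
  thus ?thesis
    using carrier_matD[OF v_carrier[of "j + 1"]]
    by (simp add: t_eq mat_adjoint_mult_dim adjoint_v hermitian mat_dim_simps)
qed

text \<open>
  The constant coefficient is right because \<open>s\<^sub>0 s\<^sub>0\<^sup>\<dagger> s\<^sub>0 = s\<^sub>0\<close>.
\<close>
lemma X_T: "fps_X \<cdot>\<^sub>m T = c0 - c0 * V * c0"
proof (rule mat_coeff_eqI)
  fix j
  have R: "mat_coeff (c0 - c0 * V * c0) j = mat_coeff c0 j - s 0 * v j * s 0"
    by (simp add: mat_coeff_mult_const mat_coeff_const_mult)
  show "mat_coeff (fps_X \<cdot>\<^sub>m T) j = mat_coeff (c0 - c0 * V * c0) j"
  proof (cases j)
    case 0
    have "s 0 * v 0 * s 0 = s 0"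
      by (simp add: reciprocal.simps[of _ _ 0] plus_transform_0 p_facts)
    hence "mat_coeff (c0 - c0 * V * c0) 0 = 0\<^sub>m q q"
      using R carrier[of 0] unfolding 0 by (metis mat_coeff_const minus_r_inv_mat)
    thus ?thesis unfolding 0 by simp
  next
    case (Suc i)
    have "mat_coeff (fps_X \<cdot>\<^sub>m T) j = t i"
      by (simp add: Suc t_carrier)
    also have "\<dots> = - (s 0 * v j * s 0)"
      by (simp add: t_eq[of i] Suc)
    finally have "mat_coeff (fps_X \<cdot>\<^sub>m T) j = - (s 0 * v j * s 0)" .
    moreover have "mat_coeff (c0 - c0 * V * c0) j = 0\<^sub>m q q - s 0 * v j * s 0"
      unfolding R using Suc by simp
    moreover have "0\<^sub>m q q - s 0 * v j * s 0 = - (s 0 * v j * s 0)"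
      by (intro eq_matI) (auto simp del: index_mult_mat(1))
    ultimately show ?thesis by (simp only:)
  qed
qed simp_all

lemma P_alpha_seq: "P * gen_fun q (alpha_seq \<alpha> s) = gen_fun q (alpha_seq \<alpha> s)"
proof (rule mat_coeff_eqI)
  fix j
  have "s 0 * (mp_inverse (s 0) * s i) = s i" for i
    using dominated[of i] by (simp add: assoc_mult_mat_dim)
  hence "p * alpha_seq \<alpha> s j = alpha_seq \<alpha> s j"
    unfolding alpha_seq_def by (simp add: fps_mat_simps)
  thus "mat_coeff (P * gen_fun q (alpha_seq \<alpha> s)) j = mat_coeff (gen_fun q (alpha_seq \<alpha> s)) j"
    by (simp add: mat_coeff_const_mult alpha_seq_carrier carrier)
qed simp_all

text \<open>
  From a polynomial \<open>M\<close> with constant term \<open>s\<^sub>0\<close> and range inside that of \<open>s\<^sub>0\<close> one gets a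
  normalized solution \<open>R\<close> of \<open>s\<^sub>0 R = M\<close>: the summand \<open>1 - p\<close> is annihilated by \<open>s\<^sub>0\<close> and completes
  the constant term \<open>s\<^sub>0\<^sup>\<dagger> s\<^sub>0 = p\<close> to the identity.
\<close>
lemma next_denominator:
  assumes M: "dim_row M = q" "dim_col M = q" "P * M = M" "mat_coeff M 0 = s 0"
    and deg: "\<forall>i>n. mat_coeff M i = 0\<^sub>m q q"
  defines "R \<equiv> g * M + const_mat (1\<^sub>m q - p)"
  shows "dim_row R = q" "dim_col R = q" "c0 * R = M" "mat_coeff R 0 = 1\<^sub>m q"
    "\<forall>i>n. mat_coeff R i = 0\<^sub>m q q"
proof -
  show "dim_row R = q" "dim_col R = q" by (simp_all add: R_def M)
  have s1: "s 0 * 1\<^sub>m q = s 0" using carrier[of 0] by simp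
  have "s 0 * (1\<^sub>m q - p) = 0\<^sub>m q q"
    using mult_minus_distrib_mat_dim[of "s 0" "1\<^sub>m q" p] carrier[of 0] by (simp add: s1 p_facts)
  hence z: "c0 * const_mat (1\<^sub>m q - p) = const_mat (0\<^sub>m q q)"
    by (simp add: const_mat_mult)
  have "c0 * R = (c0 * g) * M + c0 * const_mat (1\<^sub>m q - p)"
    unfolding R_def using M by (simp add: fps_mat_simps)
  also have "\<dots> = M"
    unfolding z const_P M(3) using M(1,2) by (intro eq_matI) auto
  finally show "c0 * R = M" .
  have R: "mat_coeff R i = mp_inverse (s 0) * mat_coeff M i + mat_coeff (const_mat (1\<^sub>m q - p)) i" for i
    unfolding R_def using M by (simp add: mat_coeff_const_mult)
  show "mat_coeff R 0 = 1\<^sub>m q"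
    unfolding R M(4) p_facts by (intro eq_matI) (auto simp del: index_mult_mat(1))
  have "mp_inverse (s 0) * 0\<^sub>m q q = 0\<^sub>m q q" by (intro right_mult_zero_mat carrier_matI) simp_all
  thus "\<forall>i>n. mat_coeff R i = 0\<^sub>m q q" unfolding R using deg by simp
qed

lemma pade_denominatorI:
  assumes f: "\<And>j. f j \<in> carrier_mat q q"
    and R: "dim_row R = q" "dim_col R = q" "mat_coeff R 0 = 1\<^sub>m q"
      "\<forall>i>n. mat_coeff R i = 0\<^sub>m q q"
    and F: "\<forall>i. n \<le> i \<and> i \<le> 2 * n \<longrightarrow> mat_coeff (gen_fun q f * R) i = (if i < 2 * n then 0\<^sub>m q q else L)"
  shows "pade_denominator q f n (mat_coeff R)" "conv q f (mat_coeff R) (2 * n) = L"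
proof -
  have "conv q f (mat_coeff R) i = mat_coeff (gen_fun q f * R) i" for i
    using R f by (simp add: mat_coeff_mult[of _ q]) (intro conv_cong, simp_all)
  thus "pade_denominator q f n (mat_coeff R)" "conv q f (mat_coeff R) (2 * n) = L"
    using F R unfolding pade_denominator_def by (auto intro: carrier_matI)
qed

lemma pade_denominatorD:
  assumes f: "\<And>j. f j \<in> carrier_mat q q" and r: "pade_denominator q f n r"
  shows "mat_coeff (gen_fun q r) 0 = 1\<^sub>m q"
    "n < i \<Longrightarrow> mat_coeff (gen_fun q r) i = 0\<^sub>m q q"
    "mat_coeff (gen_fun q f * gen_fun q r) i = conv q f r i"
    "n \<le> i \<Longrightarrow> i < 2 * n \<Longrightarrow> mat_coeff (gen_fun q f * gen_fun q r) i = 0\<^sub>m q q"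
proof -
  have r': "r j \<in> carrier_mat q q" for j using r by (simp add: pade_denominator_def)
  show c: "mat_coeff (gen_fun q f * gen_fun q r) i = conv q f r i" for i
    by (simp add: mat_coeff_mult[of _ q]) (intro conv_cong, simp_all add: f r')
  show "mat_coeff (gen_fun q r) 0 = 1\<^sub>m q"
    "n < i \<Longrightarrow> mat_coeff (gen_fun q r) i = 0\<^sub>m q q"
    "n \<le> i \<Longrightarrow> i < 2 * n \<Longrightarrow> mat_coeff (gen_fun q f * gen_fun q r) i = 0\<^sub>m q q"
    using r unfolding c by (auto simp: r' pade_denominator_def)
qed

text \<open>
  Multiplying \<open>S\<^sub>\<alpha> R = N + z\<^bsup>2n\<^esup> \<Lambda>\<close> by \<open>z\<close> and adding \<open>s\<^sub>0 R\<close> gives \<open>u R = M + z\<^bsup>2n+1\<^esup> \<Lambda>\<close> with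
  \<open>M = s\<^sub>0 R + z N\<close>.  For the solution \<open>R'\<close> of \<open>s\<^sub>0 R' = M\<close> the remainder of \<open>T R'\<close> is
  \<open>s\<^sub>0 V \<Lambda>\<close>, whose constant term is \<open>p \<Lambda>(0) = \<Lambda>(0)\<close>.
\<close>
lemma schur_first_denominator:
  assumes r: "pade_denominator q (alpha_seq \<alpha> s) n r"
  shows "\<exists>r'. pade_denominator q t n r' \<and> conv q t r' (2 * n) = conv q (alpha_seq \<alpha> s) r (2 * n)"
proof -
  have ac: "alpha_seq \<alpha> s j \<in> carrier_mat q q" for j by (simp add: alpha_seq_carrier carrier)
  define A where "A = gen_fun q (alpha_seq \<alpha> s)"
  define R where "R = gen_fun q r"
  note r = pade_denominatorD[OF ac r, folded A_def R_def]
  have [simp]: "dim_row A = q" "dim_col A = q" "dim_row R = q" "dim_col R = q" by (simp_all add: A_def R_def)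
  have PA: "P * A = A" unfolding A_def by (rule P_alpha_seq)
  have PAR: "P * (A * R) = A * R"
    by (simp add: mult_assoc_dim_eq[OF PA])
  obtain N \<Lambda> where AR: "A * R = N + fps_X ^ (2 * n) \<cdot>\<^sub>m \<Lambda>"
    and [simp]: "dim_row N = q" "dim_col N = q" "dim_row \<Lambda> = q" "dim_col \<Lambda> = q"
    and N: "\<And>i. n \<le> i \<Longrightarrow> mat_coeff N i = 0\<^sub>m q q" and PN: "P * N = N"
    and \<Lambda>: "mat_coeff \<Lambda> 0 = mat_coeff (A * R) (2 * n)" "p * mat_coeff \<Lambda> 0 = mat_coeff \<Lambda> 0"
    by (rule split_at_gap[of "A * R" q n "2 * n" p]) (use r(4) PAR in auto)
  define M where "M = c0 * R + fps_X \<cdot>\<^sub>m N"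
  have Md [simp]: "dim_row M = q" "dim_col M = q" by (simp_all add: M_def)
  have M_coeff: "mat_coeff M i = s 0 * mat_coeff R i + (if i = 0 then 0\<^sub>m q q else mat_coeff N (i - 1))" for i
    by (simp add: M_def mat_coeff_const_mult)
  have s1: "s 0 * 1\<^sub>m q = s 0" and s0: "s 0 * 0\<^sub>m q q = 0\<^sub>m q q" using carrier[of 0] by simp_all
  have PM: "P * M = M"
    by (simp add: M_def fps_mat_simps PN mult_assoc_dim_eq[OF const_P(3)])
  have M0: "mat_coeff M 0 = s 0" unfolding M_coeff using carrier[of 0] by (simp add: r(1) s1)
  have Mdeg: "\<forall>i>n. mat_coeff M i = 0\<^sub>m q q"
    unfolding M_coeff by (simp add: r(2) s0 N)
  define R' where "R' = g * M + const_mat (1\<^sub>m q - p)"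
  note R' = next_denominator[OF Md PM M0 Mdeg, folded R'_def]
  note [simp] = R'(1,2)
  have "u * R = M + fps_X ^ Suc (2 * n) \<cdot>\<^sub>m \<Lambda>"
  proof -
    have "u = fps_X \<cdot>\<^sub>m A + c0" unfolding A_def by (rule gen_fun_alpha_seq[OF carrier])
    hence "u * R = fps_X \<cdot>\<^sub>m (A * R) + c0 * R" by (simp add: fps_mat_simps)
    also have "\<dots> = M + fps_X ^ Suc (2 * n) \<cdot>\<^sub>m \<Lambda>"
      unfolding AR M_def by (intro eq_matI) (auto simp: algebra_simps simp del: index_mult_mat(1))
    finally show ?thesis .
  qed
  hence "V * (M + fps_X ^ Suc (2 * n) \<cdot>\<^sub>m \<Lambda>) = V * (u * R)" by (simp only:)
  hence VM: "V * M + fps_X ^ Suc (2 * n) \<cdot>\<^sub>m (V * \<Lambda>) = P * R"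
    by (subst (asm) mult_assoc_dim_eq[OF V_u]) (simp_all add: fps_mat_simps)
  have cVM: "c0 * (V * M) + fps_X ^ Suc (2 * n) \<cdot>\<^sub>m (c0 * (V * \<Lambda>)) = c0 * R"
    using arg_cong[OF VM, of "\<lambda>M. c0 * M"] mult_assoc_dim_eq[OF const_P(4), of R]
    by (simp add: mult_add_distrib_mat_dim smult_mult_mat_dim)
  have "fps_X \<cdot>\<^sub>m (T * R') = (c0 - c0 * V * c0) * R'"
    unfolding X_T[symmetric] by (simp add: fps_mat_simps)
  also have "\<dots> = c0 * R' - c0 * (V * (c0 * R'))"
    by (simp add: mat_dim_simps)
  also have "\<dots> = M - c0 * (V * M)" by (simp only: R'(3))
  also have "\<dots> = fps_X \<cdot>\<^sub>m N + fps_X ^ Suc (2 * n) \<cdot>\<^sub>m (c0 * (V * \<Lambda>))"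
  proof -
    define Y where "Y = c0 * (V * M)"
    have [simp]: "dim_row Y = q" "dim_col Y = q" by (simp_all add: Y_def)
    have "M = Y + fps_X ^ Suc (2 * n) \<cdot>\<^sub>m (c0 * (V * \<Lambda>)) + fps_X \<cdot>\<^sub>m N"
      unfolding Y_def cVM by (rule M_def)
    thus ?thesis unfolding Y_def[symmetric]
      by (intro eq_matI) (auto simp del: index_mult_mat(1) power_Suc)
  qed
  finally have XTR: "fps_X \<cdot>\<^sub>m (T * R') = fps_X \<cdot>\<^sub>m N + fps_X ^ Suc (2 * n) \<cdot>\<^sub>m (c0 * (V * \<Lambda>))" .
  have L: "mat_coeff (c0 * (V * \<Lambda>)) 0 = mat_coeff (A * R) (2 * n)"
    using \<Lambda>(2) by (simp add: mat_coeff_mult_0 mat_coeff_V_0 assoc_mult_mat_dim \<Lambda>(1))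
  have "mat_coeff (T * R') i = (if i < 2 * n then 0\<^sub>m q q else mat_coeff (A * R) (2 * n))"
    if i: "n \<le> i" "i \<le> 2 * n" for i
  proof -
    have ARc: "mat_coeff (A * R) (2 * n) \<in> carrier_mat q q" by (rule carrier_matI) simp_all
    have "mat_coeff (T * R') i = mat_coeff (fps_X \<cdot>\<^sub>m (T * R')) (Suc i)" by simp
    also have "\<dots> = mat_coeff N i + mat_coeff (fps_X ^ Suc (2 * n) \<cdot>\<^sub>m (c0 * (V * \<Lambda>))) (Suc i)"
      unfolding XTR by simp
    also have "mat_coeff N i = 0\<^sub>m q q" by (rule N[OF i(1)])
    also have "mat_coeff (fps_X ^ Suc (2 * n) \<cdot>\<^sub>m (c0 * (V * \<Lambda>))) (Suc i) =
        (if i < 2 * n then 0\<^sub>m q q else mat_coeff (A * R) (2 * n))"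
      unfolding mat_coeff_shift L[symmetric] using i(2) by (simp del: mat_coeff_gen_fun)
    finally show ?thesis using left_add_zero_mat[OF ARc] by (simp split: if_splits)
  qed
  hence F: "\<forall>i. n \<le> i \<and> i \<le> 2 * n \<longrightarrow>
      mat_coeff (T * R') i = (if i < 2 * n then 0\<^sub>m q q else conv q (alpha_seq \<alpha> s) r (2 * n))"
    by (simp add: r(3))
  from pade_denominatorI[where f = t, OF t_carrier R'(1,2,4,5) F] show ?thesis by blast
qed

text \<open>
  Here \<open>S R = N + z\<^bsup>2n+2\<^esup> \<Lambda>\<close> and \<open>s\<^sub>0 R' = N\<close>.  With \<open>W = (1 - \<alpha>z) V\<close>, for which \<open>W S = P\<close>, one has
  \<open>z (z T\<^sub>\<alpha> + t\<^sub>0) = (1 - \<alpha>z) s\<^sub>0 - s\<^sub>0 W s\<^sub>0\<close>, so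
  \<open>z\<^sup>2 T\<^sub>\<alpha> R' = (1 - \<alpha>z) N - s\<^sub>0 R - z t\<^sub>0 R' + z\<^bsup>2n+2\<^esup> s\<^sub>0 W \<Lambda>\<close>.  The first three summands have degree at
  most \<open>n + 1\<close>, so they do not reach the coefficients at \<open>n + 2\<close> and above, which are the
  coefficients of \<open>T\<^sub>\<alpha> R'\<close> at \<open>n\<close> and above.
\<close>
lemma alpha_schur_first_denominator:
  assumes r: "pade_denominator q s (Suc n) r"
  shows "\<exists>r'. pade_denominator q (alpha_seq \<alpha> t) n r' \<and>
           conv q (alpha_seq \<alpha> t) r' (2 * n) = conv q s r (2 * Suc n)"
proof -
  have ac: "alpha_seq \<alpha> t j \<in> carrier_mat q q" for j by (simp add: alpha_seq_carrier t_carrier)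
  define A where "A = gen_fun q (alpha_seq \<alpha> t)"
  define R where "R = gen_fun q r"
  note r = pade_denominatorD[OF carrier r, folded R_def]
  have [simp]: "dim_row A = q" "dim_col A = q" "dim_row R = q" "dim_col R = q" by (simp_all add: A_def R_def)
  have PSR: "P * (S * R) = S * R"
    by (simp add: mult_assoc_dim_eq[OF P_S])
  obtain N \<Lambda> where SR: "S * R = N + fps_X ^ (2 * Suc n) \<cdot>\<^sub>m \<Lambda>"
    and [simp]: "dim_row N = q" "dim_col N = q" "dim_row \<Lambda> = q" "dim_col \<Lambda> = q"
    and N: "\<And>i. Suc n \<le> i \<Longrightarrow> mat_coeff N i = 0\<^sub>m q q"
    and NSR: "\<And>i. i < Suc n \<Longrightarrow> mat_coeff N i = mat_coeff (S * R) i" and PN: "P * N = N"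
    and \<Lambda>: "mat_coeff \<Lambda> 0 = mat_coeff (S * R) (2 * Suc n)" "p * mat_coeff \<Lambda> 0 = mat_coeff \<Lambda> 0"
    by (rule split_at_gap[of "S * R" q "Suc n" "2 * Suc n" p]) (use r(4) PSR in auto)
  have N0: "mat_coeff N 0 = s 0"
    using NSR[of 0] carrier[of 0] by (simp add: mat_coeff_mult_0 r(1) carrier)
  have Nd: "dim_row N = q" "dim_col N = q" by simp_all
  have Ndeg: "\<forall>i>n. mat_coeff N i = 0\<^sub>m q q" using N by simp
  define R' where "R' = g * N + const_mat (1\<^sub>m q - p)"
  note R' = next_denominator[OF Nd PN N0 Ndeg, folded R'_def]
  note [simp] = R'(1,2)
  define W where "W = c \<cdot>\<^sub>m V"
  have [simp]: "dim_row W = q" "dim_col W = q" by (simp_all add: W_def)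
  have WS: "W * S = P"
    using V_u by (simp add: W_def fps_mat_simps)
  have "W * (N + fps_X ^ (2 * Suc n) \<cdot>\<^sub>m \<Lambda>) = W * (S * R)" by (simp only: SR)
  hence WN: "W * N + fps_X ^ (2 * Suc n) \<cdot>\<^sub>m (W * \<Lambda>) = P * R"
    by (subst (asm) mult_assoc_dim_eq[OF WS]) (simp_all add: fps_mat_simps del: mult_Suc_right power_Suc)
  have cWN: "c0 * (W * N) + fps_X ^ (2 * Suc n) \<cdot>\<^sub>m (c0 * (W * \<Lambda>)) = c0 * R"
    using arg_cong[OF WN, of "\<lambda>M. c0 * M"] mult_assoc_dim_eq[OF const_P(4), of R]
    by (simp add: mult_add_distrib_mat_dim smult_mult_mat_dim del: mult_Suc_right power_Suc)
  note [simp] = carrier_matD[OF t_carrier]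
  have "fps_X \<cdot>\<^sub>m (fps_X \<cdot>\<^sub>m A + const_mat (t 0)) = c \<cdot>\<^sub>m (fps_X \<cdot>\<^sub>m T)"
    unfolding A_def gen_fun_alpha_seq[where s = t, OF t_carrier, symmetric]
    by (simp only: smult_smult_mat mult.commute[of fps_X])
  also have "\<dots> = c \<cdot>\<^sub>m c0 - c0 * W * c0"
    unfolding X_T W_def by (simp add: fps_mat_simps)
  finally have XXA: "fps_X \<cdot>\<^sub>m (fps_X \<cdot>\<^sub>m A + const_mat (t 0)) = c \<cdot>\<^sub>m c0 - c0 * W * c0" .
  have "fps_X \<cdot>\<^sub>m (fps_X \<cdot>\<^sub>m (A * R') + const_mat (t 0) * R') = (c \<cdot>\<^sub>m c0 - c0 * W * c0) * R'"
    unfolding XXA[symmetric] by (simp add: fps_mat_simps)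
  also have "\<dots> = c \<cdot>\<^sub>m (c0 * R') - c0 * (W * (c0 * R'))"
    by (simp add: fps_mat_simps)
  also have "\<dots> = c \<cdot>\<^sub>m N - c0 * (W * N)" by (simp only: R'(3))
  finally have *: "fps_X \<cdot>\<^sub>m (fps_X \<cdot>\<^sub>m (A * R') + const_mat (t 0) * R') = c \<cdot>\<^sub>m N - c0 * (W * N)" .
  \<comment> \<open>With \<open>s\<^sub>0 R\<close> on the left, the right side is a polynomial of degree at most \<open>n + 1\<close> plus the
    remainder; no division by \<open>z\<^sup>2\<close> is needed, since coefficients are compared two places later.\<close>
  have XXAR: "fps_X \<cdot>\<^sub>m (fps_X \<cdot>\<^sub>m (A * R') + const_mat (t 0) * R') + c0 * R =
     c \<cdot>\<^sub>m N + fps_X ^ (2 * Suc n) \<cdot>\<^sub>m (c0 * (W * \<Lambda>))"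
    unfolding * cWN[symmetric]
    by (intro eq_matI) (auto simp del: index_mult_mat(1) mult_Suc_right power_Suc)
  have L: "mat_coeff (c0 * (W * \<Lambda>)) 0 = mat_coeff (S * R) (2 * Suc n)"
  proof -
    have "mat_coeff W 0 = mp_inverse (s 0)"
      unfolding W_def by (simp add: mat_coeff_linear_factor mat_coeff_V_0)
        (intro eq_matI, auto)
    thus ?thesis using \<Lambda>
      by (simp add: mat_coeff_mult_0 assoc_mult_mat_dim del: mult_Suc_right)
  qed
  have z: "M * 0\<^sub>m q q = 0\<^sub>m q q" if "dim_row M = q" "dim_col M = q" for M :: "complex mat"
    using that by (intro right_mult_zero_mat carrier_matI)
  have "mat_coeff (A * R') i = (if i < 2 * n then 0\<^sub>m q q else mat_coeff (S * R) (2 * Suc n))"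
    if i: "n \<le> i" "i \<le> 2 * n" for i
  proof -
    have ARc: "mat_coeff (A * R') i \<in> carrier_mat q q" "mat_coeff (S * R) (2 * Suc n) \<in> carrier_mat q q"
      by (rule carrier_matI, simp_all)+
    have "mat_coeff (A * R') i =
        mat_coeff (fps_X \<cdot>\<^sub>m (fps_X \<cdot>\<^sub>m (A * R') + const_mat (t 0) * R') + c0 * R) (Suc (Suc i))"
      using i ARc by (simp add: mat_coeff_const_mult R'(5) r(2) z)
    also have "\<dots> = mat_coeff (fps_X ^ (2 * Suc n) \<cdot>\<^sub>m (c0 * (W * \<Lambda>))) (Suc (Suc i))"
      unfolding XXAR using i
      by (subst mat_coeff_add) (auto simp: mat_coeff_linear_factor N simp del: mult_Suc_right power_Suc mat_coeff_shift
          intro!: eq_matI)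
    also have "\<dots> = (if i < 2 * n then 0\<^sub>m q q else mat_coeff (S * R) (2 * Suc n))"
      unfolding mat_coeff_shift L[symmetric] using i(2) by (simp del: mat_coeff_gen_fun)
    finally show ?thesis .
  qed
  hence F: "\<forall>i. n \<le> i \<and> i \<le> 2 * n \<longrightarrow>
      mat_coeff (gen_fun q (alpha_seq \<alpha> t) * R') i = (if i < 2 * n then 0\<^sub>m q q else conv q s r (2 * Suc n))"
    by (simp add: r(3) A_def del: mult_Suc_right)
  from pade_denominatorI[where f = "alpha_seq \<alpha> t", OF ac R'(1,2,4,5) F] show ?thesis by blast
qed

end

section \<open>One Schur step and the iteration\<close>

lemma alpha_seq_cong:
  assumes "s j = s' j" "s (j + 1) = s' (j + 1)"
  shows "alpha_seq \<alpha> s j = alpha_seq \<alpha> s' j"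
  using assms by (simp add: alpha_seq_def)

lemma adjoint_alpha_seq:
  assumes "s j \<in> carrier_mat q q" "s (j + 1) \<in> carrier_mat q q"
    "mat_adjoint (s j) = s j" "mat_adjoint (s (j + 1)) = s (j + 1)"
  shows "mat_adjoint (alpha_seq \<alpha> s j) = alpha_seq \<alpha> s j"
  using assms unfolding alpha_seq_def by (subst mat_adjoint_add[of _ q q]) (auto simp: mat_adjoint_smult)

lemma reciprocal_cong:
  assumes "\<And>i. i \<le> j \<Longrightarrow> u i = u' i"
  shows "reciprocal q u j = reciprocal q u' j"
  using assms
proof (induction j rule: less_induct)
  case (less j)
  have "mat_sum q (\<lambda>l. u (j - l) * reciprocal q u l) j = mat_sum q (\<lambda>l. u' (j - l) * reciprocal q u' l) j"
  proof (rule mat_sum_cong)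
    fix l assume l: "l < j"
    have "reciprocal q u l = reciprocal q u' l" using l by (intro less.IH less.prems) simp_all
    thus "u (j - l) * reciprocal q u l = u' (j - l) * reciprocal q u' l" using less.prems[of "j - l"] by simp
  qed simp_all
  thus ?case using less.prems[of 0] by (simp add: reciprocal.simps[of q _ j])
qed

lemma schur_first_cong:
  assumes "\<And>i. i \<le> j + 1 \<Longrightarrow> s i = s' i"
  shows "schur_first q \<alpha> s j = schur_first q \<alpha> s' j"
proof -
  have "reciprocal q (plus_transform q \<alpha> s) (j + 1) = reciprocal q (plus_transform q \<alpha> s') (j + 1)"
    using assms by (intro reciprocal_cong) (simp add: plus_transform_def)
  thus ?thesis using assms[of 0] by (simp add: schur_first_def)
qed

lemma pade_denominator_cong:
  assumes "\<And>j. j < 2 * n \<Longrightarrow> s j = s' j"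
  shows "pade_denominator q s n r \<longleftrightarrow> pade_denominator q s' n r"
proof -
  have "conv q s r i = conv q s' r i" if "i < 2 * n" for i
    using that assms by (intro conv_cong) auto
  thus ?thesis by (auto simp: pade_denominator_def)
qed

text \<open>
  The property that is passed along the iteration, for sequences with index set \<open>{0..m}\<close>.  The bounds
  on \<open>n\<close> say that the entries occurring in the Pade problem of order \<open>n\<close>, which are those with index
  at most \<open>2n - 1\<close> of the respective sequence, are among the admissible ones.
\<close>
definition hermitian_pade_solvable :: "nat \<Rightarrow> real \<Rightarrow> nat \<Rightarrow> (nat \<Rightarrow> complex mat) \<Rightarrow> bool" where
  "hermitian_pade_solvable q \<alpha> m s \<longleftrightarrow>
     (\<forall>j\<le>m. s j \<in> carrier_mat q q \<and> mat_adjoint (s j) = s j) \<and>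
     (\<forall>n. 2 * n \<le> m + 1 \<longrightarrow> (\<exists>r. pade_denominator q s n r)) \<and>
     (\<forall>n. 2 * n \<le> m \<longrightarrow> (\<exists>r. pade_denominator q (alpha_seq \<alpha> s) n r))"

lemma hermitian_pade_solvable_cong:
  assumes "\<And>j. j \<le> m \<Longrightarrow> s j = s' j" "hermitian_pade_solvable q \<alpha> m s"
  shows "hermitian_pade_solvable q \<alpha> m s'"
proof -
  have 1: "pade_denominator q s n r \<longleftrightarrow> pade_denominator q s' n r" if "2 * n \<le> m + 1" for n r
    using that by (intro pade_denominator_cong assms(1)) linarith
  have 2: "pade_denominator q (alpha_seq \<alpha> s) n r \<longleftrightarrow> pade_denominator q (alpha_seq \<alpha> s') n r" if "2 * n \<le> m" for n r
    using that by (intro pade_denominator_cong alpha_seq_cong assms(1)) linarith+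
  note s = assms(2)[unfolded hermitian_pade_solvable_def]
  show ?thesis
    unfolding hermitian_pade_solvable_def
  proof (intro conjI allI impI)
    fix j assume j: "j \<le> m"
    thus "s' j \<in> carrier_mat q q" "mat_adjoint (s' j) = s' j"
      using s by (simp_all flip: assms(1)[OF j])
  next
    fix n assume n: "2 * n \<le> m + 1"
    thus "\<exists>r. pade_denominator q s' n r" using s by (simp flip: 1[OF n])
  next
    fix n assume n: "2 * n \<le> m"
    thus "\<exists>r. pade_denominator q (alpha_seq \<alpha> s') n r" using s by (simp flip: 2[OF n])
  qed
qed

text \<open>
  The last equation of the Pade problem expresses the newest entry \<open>f\<^bsub>2n+1\<^esub>\<close> by
  \<open>f\<^sub>n, \<dots>, f\<^bsub>2n\<^esub>\<close>, each multiplied from the right, so its range is inside the sum of their ranges.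
\<close>
lemma denominator_dominated:
  assumes f: "\<And>j. j \<le> 2 * n + 1 \<Longrightarrow> f j \<in> carrier_mat q q" and p: "p \<in> carrier_mat q q"
    and r: "pade_denominator q f (Suc n) r" and pf: "\<And>j. j \<le> 2 * n \<Longrightarrow> p * f j = f j"
  shows "p * f (2 * n + 1) = f (2 * n + 1)"
proof -
  note r' = r[unfolded pade_denominator_def]
  have rc: "r l \<in> carrier_mat q q" for l using r' by blast
  define w where "w = mat_sum q (\<lambda>k. f (n + k) * r (Suc n - k)) (Suc n)"
  have w: "w \<in> carrier_mat q q" by (simp add: w_def)
  have fw: "f (2 * n + 1) = - w"
  proof -
    have "conv q f r (Suc n + n) = f (Suc n + n) + w"
      unfolding w_def using r' f by (intro conv_polynomial) simp_all
    moreover have "conv q f r (Suc n + n) = 0\<^sub>m q q" using r' by simp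
    ultimately have "w + f (2 * n + 1) = 0\<^sub>m q q"
      using f[of "2 * n + 1"] w by (simp add: mult_2 comm_add_mat[of w q q])
    thus ?thesis using add_eq_0_mat_iff[of w q q] w f[of "2 * n + 1"] by simp
  qed
  have "p * w = mat_sum q (\<lambda>k. p * (f (n + k) * r (Suc n - k))) (Suc n)"
    unfolding w_def using f by (intro mult_mat_sum p mult_carrier_mat[OF _ rc]) simp
  also have "\<dots> = w"
    unfolding w_def
  proof (rule mat_sum_cong)
    fix k assume "k < Suc n"
    hence k: "n + k \<le> 2 * n" "n + k \<le> 2 * n + 1" by auto
    show "p * (f (n + k) * r (Suc n - k)) = f (n + k) * r (Suc n - k)"
      unfolding assoc_mult_mat[OF p f[OF k(2)] rc, symmetric] pf[OF k(1)] ..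
  qed simp_all
  finally show ?thesis unfolding fw using p w by simp
qed

text \<open>
  Induction on \<open>j\<close>: the Pade problem for \<open>(s\<^sub>j)\<close> controls the entries with odd index, and the one for
  \<open>(s\<^bsub>\<alpha>,j\<^esub>)\<close> controls \<open>s\<^bsub>\<alpha>,2n+1\<^esub> = - \<alpha> s\<^bsub>2n+1\<^esub> + s\<^bsub>2n+2\<^esub>\<close>, hence the entries with even index.
\<close>
lemma hermitian_pade_solvable_dominated:
  assumes s: "hermitian_pade_solvable q \<alpha> m s" and "j \<le> m"
  shows "s 0 * mp_inverse (s 0) * s j = s j"
  using \<open>j \<le> m\<close>
proof (induction j rule: less_induct)
  case (less j)
  define p where "p = s 0 * mp_inverse (s 0)"
  have car: "s i \<in> carrier_mat q q" if "i \<le> m" for i using s that by (auto simp: hermitian_pade_solvable_def)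
  have p: "p \<in> carrier_mat q q"
    unfolding p_def using car[of 0] mp_inverse(1)[OF car[of 0]] by (intro mult_carrier_mat) auto
  have IH: "p * s i = s i" if "i < j" for i using less.IH[OF that] less.prems that by (simp add: p_def)
  have "p * s j = s j"
  proof (cases "even j")
    case False
    then obtain n where n: "j = 2 * n + 1" by (rule oddE)
    obtain r where r: "pade_denominator q s (Suc n) r"
      using s less.prems n unfolding hermitian_pade_solvable_def by (metis add_le_mono1 mult_Suc_right add_2_eq_Suc Suc_eq_plus1 add.commute)
    show ?thesis unfolding n
      by (rule denominator_dominated[OF _ p r]) (use n less.prems in \<open>auto intro!: car IH\<close>)
  next
    case True
    show ?thesis
    proof (cases "j = 0")
      case True
      thus ?thesis using mp_inverse(2)[OF car[of 0]] by (simp add: p_def)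
    next
      case False
      with \<open>even j\<close> obtain n where n: "j = 2 * Suc n" by (metis evenE mult_0_right not0_implies_Suc)
      obtain r where r: "pade_denominator q (alpha_seq \<alpha> s) (Suc n) r"
        using s less.prems n unfolding hermitian_pade_solvable_def by blast
      have pa: "p * alpha_seq \<alpha> s i = (- complex_of_real \<alpha>) \<cdot>\<^sub>m (p * s i) + p * s (i + 1)" if "i + 1 \<le> m" for i
        unfolding alpha_seq_def using carrier_matD[OF p] carrier_matD[OF car[of i]] carrier_matD[OF car[of "i + 1"]] that
        by (simp add: mult_add_distrib_mat_dim smult_mult_mat_dim)
      have "p * alpha_seq \<alpha> s (2 * n + 1) = alpha_seq \<alpha> s (2 * n + 1)"
      proof (rule denominator_dominated[OF _ p r])
        fix i assume "i \<le> 2 * n + 1"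
        thus "alpha_seq \<alpha> s i \<in> carrier_mat q q"
          using n less.prems by (intro alpha_seq_carrier car) auto
      next
        fix i assume i: "i \<le> 2 * n"
        have "p * s i = s i" "p * s (i + 1) = s (i + 1)" using i n by (auto intro!: IH)
        thus "p * alpha_seq \<alpha> s i = alpha_seq \<alpha> s i"
          using pa[of i] i n less.prems by (simp add: alpha_seq_def)
      qed
      hence *: "(- complex_of_real \<alpha>) \<cdot>\<^sub>m s (2 * n + 1) + p * s j = (- complex_of_real \<alpha>) \<cdot>\<^sub>m s (2 * n + 1) + s j"
        using pa[of "2 * n + 1"] IH[of "2 * n + 1"] n less.prems by (simp add: alpha_seq_def)
      show ?thesis
      proof (rule eq_matI)
        fix a b assume ab: "a < dim_row (s j)" "b < dim_col (s j)"
        have d: "dim_row (p * s j) = dim_row (s j)" "dim_col (p * s j) = dim_col (s j)"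
          "dim_row (s (2 * n + 1)) = dim_row (s j)" "dim_col (s (2 * n + 1)) = dim_col (s j)"
          using p car[of j] car[of "2 * n + 1"] n less.prems by auto
        show "(p * s j) $$ (a, b) = s j $$ (a, b)"
          using arg_cong[OF *, of "\<lambda>M. M $$ (a, b)"] ab d by (simp del: index_mult_mat)
      qed (use p car[of j] less.prems in auto)
    qed
  qed
  thus ?case by (simp add: p_def)
qed

text \<open>
  The two transfer lemmas exchange the roles of the sequences: the problem of order \<open>n\<close> for
  \<open>(s\<^bsub>\<alpha>,j\<^esub>)\<close> becomes the one for \<open>(t\<^sub>j)\<close>, and that of order \<open>n + 1\<close> for \<open>(s\<^sub>j)\<close> becomes the one of order
  \<open>n\<close> for \<open>(t\<^bsub>\<alpha>,j\<^esub>)\<close>, in both cases with the same remainder.  This gives solvability for \<open>t\<close>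
  together with \<open>L\<^sub>n(t) = L\<^bsub>\<alpha>,n\<^esub>(s)\<close> and \<open>L\<^bsub>\<alpha>,n\<^esub>(t) = L\<^bsub>n+1\<^esub>(s)\<close>.
\<close>
lemma schur_first_step:
  assumes s: "hermitian_pade_solvable q \<alpha> (Suc m) s"
  shows "hermitian_pade_solvable q \<alpha> m (schur_first q \<alpha> s)"
    and "j \<le> m \<Longrightarrow> stieltjes_param q \<alpha> (schur_first q \<alpha> s) j = stieltjes_param q \<alpha> s (Suc j)"
proof -
  \<comment> \<open>Entries beyond the index set carry no information; replacing them by \<open>0\<close> makes the power
    series identities hold without truncation.\<close>
  define s' where "s' = (\<lambda>j. if j \<le> Suc m then s j else 0\<^sub>m q q)"
  define t where "t = schur_first q \<alpha> s"
  define t' where "t' = schur_first q \<alpha> s'"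
  have s's: "s' j = s j" if "j \<le> Suc m" for j using that by (simp add: s'_def)
  have t't: "t' j = t j" if "j \<le> m" for j
    unfolding t_def t'_def using that by (intro schur_first_cong s's) simp
  have as: "alpha_seq \<alpha> s' j = alpha_seq \<alpha> s j" if "j \<le> m" for j
    using that by (intro alpha_seq_cong s's) simp_all
  have at: "alpha_seq \<alpha> t' j = alpha_seq \<alpha> t j" if "j + 1 \<le> m" for j
    using that by (intro alpha_seq_cong t't) simp_all
  have cs: "s j \<in> carrier_mat q q" "mat_adjoint (s j) = s j" if "j \<le> Suc m" for j
    using s that by (auto simp: hermitian_pade_solvable_def)
  interpret range_dominated_sequence q \<alpha> s'
  proof
    fix j
    have z: "s 0 * mp_inverse (s 0) * 0\<^sub>m q q = 0\<^sub>m q q"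
      using cs(1)[of 0] mp_inverse(1)[OF cs(1)[of 0]] by (intro right_mult_zero_mat[of _ q]) auto
    show "s' j \<in> carrier_mat q q" "mat_adjoint (s' j) = s' j" by (simp_all add: s'_def cs)
    show "s' 0 * mp_inverse (s' 0) * s' j = s' j"
      using hermitian_pade_solvable_dominated[OF s, of j] z by (simp add: s'_def)
  qed
  have ct: "t j \<in> carrier_mat q q" "mat_adjoint (t j) = t j" if "j \<le> m" for j
    using t_carrier[of j] adjoint_t[of j] t't[OF that] by (simp_all flip: t'_def)
  have step1: "\<exists>r r'. pade_denominator q t n r' \<and> pade_denominator q (alpha_seq \<alpha> s) n r \<and>
      (2 * n \<le> m \<longrightarrow> conv q t r' (2 * n) = conv q (alpha_seq \<alpha> s) r (2 * n))" if n: "2 * n \<le> m + 1" for n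
  proof -
    obtain r where r: "pade_denominator q (alpha_seq \<alpha> s) n r"
      using s n unfolding hermitian_pade_solvable_def by auto
    have "pade_denominator q (alpha_seq \<alpha> s') n r \<longleftrightarrow> pade_denominator q (alpha_seq \<alpha> s) n r"
      using n by (intro pade_denominator_cong as) linarith
    then obtain r' where r': "pade_denominator q t' n r'" "conv q t' r' (2 * n) = conv q (alpha_seq \<alpha> s') r (2 * n)"
      using schur_first_denominator[of n r] r unfolding t'_def by blast
    have "pade_denominator q t' n r' \<longleftrightarrow> pade_denominator q t n r'"
      using n by (intro pade_denominator_cong t't) linarith
    moreover have "conv q t' r' (2 * n) = conv q t r' (2 * n)" if "2 * n \<le> m"
      using that by (intro conv_cong t't refl) linarith
    moreover have "conv q (alpha_seq \<alpha> s') r (2 * n) = conv q (alpha_seq \<alpha> s) r (2 * n)" if "2 * n \<le> m"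
      using that by (intro conv_cong as refl) linarith
    ultimately show ?thesis using r r' by metis
  qed
  have step2: "\<exists>r r'. pade_denominator q (alpha_seq \<alpha> t) n r' \<and> pade_denominator q s (Suc n) r \<and>
      (2 * n + 1 \<le> m \<longrightarrow> conv q (alpha_seq \<alpha> t) r' (2 * n) = conv q s r (2 * Suc n))" if n: "2 * n \<le> m" for n
  proof -
    have "2 * Suc n \<le> Suc m + 1" using n by simp
    then obtain r where r: "pade_denominator q s (Suc n) r"
      using s unfolding hermitian_pade_solvable_def by blast
    have "pade_denominator q s' (Suc n) r \<longleftrightarrow> pade_denominator q s (Suc n) r"
      using n by (intro pade_denominator_cong s's) simp
    then obtain r' where r': "pade_denominator q (alpha_seq \<alpha> t') n r'"
        "conv q (alpha_seq \<alpha> t') r' (2 * n) = conv q s' r (2 * Suc n)"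
      using alpha_schur_first_denominator[of n r] r unfolding t'_def by blast
    have "pade_denominator q (alpha_seq \<alpha> t') n r' \<longleftrightarrow> pade_denominator q (alpha_seq \<alpha> t) n r'"
      using n by (intro pade_denominator_cong at) linarith
    moreover have "conv q (alpha_seq \<alpha> t') r' (2 * n) = conv q (alpha_seq \<alpha> t) r' (2 * n)" if "2 * n + 1 \<le> m"
      using that by (intro conv_cong at refl) linarith
    moreover have "conv q s' r (2 * Suc n) = conv q s r (2 * Suc n)" if "2 * n + 1 \<le> m"
      using that by (intro conv_cong s's refl) simp
    ultimately show ?thesis using r r' by metis
  qed
  show "hermitian_pade_solvable q \<alpha> m (schur_first q \<alpha> s)"
    unfolding hermitian_pade_solvable_def t_def[symmetric] using ct step1 step2 by meson
  show "stieltjes_param q \<alpha> (schur_first q \<alpha> s) j = stieltjes_param q \<alpha> s (Suc j)" if j: "j \<le> m"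
  proof (cases "even j")
    case True
    then obtain n where n: "j = 2 * n" by (rule evenE)
    have nm: "2 * n \<le> m" "2 * n \<le> m + 1" using n j by simp_all
    obtain r r' where r: "pade_denominator q t n r'" "pade_denominator q (alpha_seq \<alpha> s) n r"
      "conv q t r' (2 * n) = conv q (alpha_seq \<alpha> s) r (2 * n)"
      using step1[OF nm(2)] nm(1) by blast
    have "schur_L q t n = conv q t r' (2 * n)"
      by (rule schur_L_eq_conv[OF _ _ r(1)]; rule ct; use nm in linarith)
    also have "\<dots> = conv q (alpha_seq \<alpha> s) r (2 * n)" by (rule r(3))
    also have "\<dots> = schur_L q (alpha_seq \<alpha> s) n"
      by (rule schur_L_eq_conv[OF _ _ r(2), symmetric]; (rule alpha_seq_carrier adjoint_alpha_seq; rule cs; use nm in linarith))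
    finally show ?thesis unfolding t_def[symmetric] using n by (simp add: stieltjes_param_def)
  next
    case False
    then obtain n where n: "j = 2 * n + 1" by (rule oddE)
    have nm: "2 * n \<le> m" "2 * n + 1 \<le> m" using n j by simp_all
    obtain r r' where r: "pade_denominator q (alpha_seq \<alpha> t) n r'" "pade_denominator q s (Suc n) r"
      "conv q (alpha_seq \<alpha> t) r' (2 * n) = conv q s r (2 * Suc n)"
      using step2[OF nm(1)] nm(2) by blast
    have "schur_L q (alpha_seq \<alpha> t) n = conv q (alpha_seq \<alpha> t) r' (2 * n)"
      by (rule schur_L_eq_conv[OF _ _ r(1)]; (rule alpha_seq_carrier adjoint_alpha_seq; rule ct; use nm in linarith))
    also have "\<dots> = conv q s r (2 * Suc n)" by (rule r(3))
    also have "\<dots> = schur_L q s (Suc n)"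
      by (rule schur_L_eq_conv[OF _ _ r(2), symmetric]; rule cs; use nm in simp)
    finally show ?thesis unfolding t_def[symmetric] using n by (simp add: stieltjes_param_def)
  qed
qed

lemma schur_transform_Suc_shift:
  "schur_transform q \<alpha> (Suc k) s = schur_transform q \<alpha> k (schur_first q \<alpha> s)"
  by (induction k) simp_all

lemma schur_transform_0_eq_stieltjes_param:
  assumes "hermitian_pade_solvable q \<alpha> m s" "j \<le> m"
  shows "schur_transform q \<alpha> j s 0 = stieltjes_param q \<alpha> s j"
  using assms
proof (induction j arbitrary: m s)
  case 0
  show ?case by (simp add: stieltjes_param_def schur_L_def)
next
  case (Suc j)
  obtain m' where m: "m = Suc m'" "j \<le> m'" using Suc.prems(2) by (cases m) auto
  note step = schur_first_step[OF Suc.prems(1)[unfolded m(1)]]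
  show ?case
    unfolding schur_transform_Suc_shift Suc.IH[OF step(1) m(2)] by (rule step(2)[OF m(2)])
qed

text \<open>
  The top positive semidefinite Hankel matrices contain all smaller ones as leading blocks.  One
  entry is lost because order \<open>n\<close> needs \<open>H\<^sub>n \<ge> 0\<close>, which involves \<open>s\<^bsub>2n\<^esub>\<close>, although the Pade problem
  itself stops at \<open>s\<^bsub>2n-1\<^esub>\<close>; this is where extendability enters.
\<close>
lemma K_fin_imp_hermitian_pade_solvable:
  assumes K: "K_fin q (m + 1) \<alpha> s"
  shows "hermitian_pade_solvable q \<alpha> m s"
proof -
  define k where "k = (m + 1) div 2"
  define l where "l = m div 2"
  have car: "s j \<in> carrier_mat q q" if "j \<le> m + 1" for j using K that by (simp add: K_fin_def)
  have H: "nonneg_hermitian (block_hankel q s k)" "nonneg_hermitian (block_hankel q (alpha_seq \<alpha> s) l)"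
  proof -
    have "l = (if even (m + 1) then (m + 1) div 2 - 1 else (m + 1) div 2)" unfolding l_def by auto
    thus "nonneg_hermitian (block_hankel q s k)" "nonneg_hermitian (block_hankel q (alpha_seq \<alpha> s) l)"
      using K by (auto simp: K_fin_def k_def split: if_splits)
  qed
  have kl: "2 * k \<le> m + 1" "m \<le> 2 * k" "2 * l \<le> m" by (auto simp: k_def l_def)
  have acar: "alpha_seq \<alpha> s j \<in> carrier_mat q q" if "j \<le> 2 * l" for j
    by (rule alpha_seq_carrier; rule car; use that kl in linarith)
  have herm: "mat_adjoint (s j) = s j" if "j \<le> m" for j
  proof -
    have "mat_adjoint (block_hankel q s k) = block_hankel q s k" using H(1) by (simp add: nonneg_hermitian_def)
    hence "\<forall>j \<le> 2 * k. mat_adjoint (s j) = s j"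
      by (subst (asm) block_hankel_hermitian_iff) (rule car, use kl in auto)
    thus ?thesis using that kl by simp
  qed
  have d1: "\<exists>r. pade_denominator q s n r" if "2 * n \<le> m + 1" for n
  proof -
    have n: "n \<le> k" using that by (simp add: k_def)
    have "nonneg_hermitian (block_hankel q s n)"
      by (rule block_hankel_nonneg_mono[OF H(1) car n]) (use kl in linarith)
    thus ?thesis by (intro pade_denominator_exists car) (use that in linarith)
  qed
  have d2: "\<exists>r. pade_denominator q (alpha_seq \<alpha> s) n r" if "2 * n \<le> m" for n
  proof -
    have n: "n \<le> l" using that by (simp add: l_def)
    have "nonneg_hermitian (block_hankel q (alpha_seq \<alpha> s) n)"
      by (rule block_hankel_nonneg_mono[OF H(2) acar n])
    thus ?thesis by (intro pade_denominator_exists acar) (use n in linarith)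
  qed
  show ?thesis unfolding hermitian_pade_solvable_def using car herm d1 d2 by auto
qed

theorem theorem9p15:
  fixes q :: nat and \<alpha> :: real and \<kappa> :: enat and s :: "nat \<Rightarrow> complex mat"
  assumes "q \<ge> 1"
    and "K_ext q \<kappa> \<alpha> s"
  shows "\<forall>j. enat j \<le> \<kappa> \<longrightarrow> schur_transform q \<alpha> j s 0 = stieltjes_param q \<alpha> s j"
proof (intro allI impI)
  fix j assume j: "enat j \<le> \<kappa>"
  have "\<exists>m\<ge>j. hermitian_pade_solvable q \<alpha> m s"
  proof (cases \<kappa>)
    case (enat m)
    then obtain S where "K_fin q (m + 1) \<alpha> (s(m + 1 := S))"
      using assms(2) by (auto simp: K_ext_def)
    hence "hermitian_pade_solvable q \<alpha> m (s(m + 1 := S))" by (rule K_fin_imp_hermitian_pade_solvable)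
    hence "hermitian_pade_solvable q \<alpha> m s" by (rule hermitian_pade_solvable_cong[rotated]) simp
    thus ?thesis using j enat by auto
  next
    case infinity
    hence "K_fin q (j + 1) \<alpha> s" using assms(2) by (simp add: K_ext_def K_inf_def)
    thus ?thesis using K_fin_imp_hermitian_pade_solvable by blast
  qed
  thus "schur_transform q \<alpha> j s 0 = stieltjes_param q \<alpha> s j"
    using schur_transform_0_eq_stieltjes_param by blast
qed

end
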